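(* Let $T>0$ be any finite time horizon. Assume: (i) $\Delta_2$ is invertible; (ii) the algebraic Riccati equation $A_{22}^*P+PA_{22}+P\Delta_2P+Q_2=0$ admits a solution $\overline P_{22}\in\mathbb S^{n_2}$ such that all eigenvalues of $S:=A_{22}+\Delta_2\overline P_{22}$ have strictly negative real parts; (iii) the differential Riccati equation $\frac{d\overline P_{11}}{dt}+\widetilde A^*\overline P_{11}+\overline P_{11}\widetilde A+\overline P_{11}M\overline P_{11}+N=0$ on $[0,T]$, $\overline P_{11}(T)=0$, admits a unique solution $\overline P_{11}\in C([0,T];\mathbb S^{n_1})$; (iv) there is $\gamma>0$ with $\frac12(S^*+S)\le-\gamma I$; (v) for some $\delta\in(0,\gamma)$, $-\overline P_{22}$ lies in the interior of the closed ball $B_{\delta,q_2}$. Then there exists a positive constant $\epsilon^*$ such that for all $0<\epsilon<\epsilon^*$ the full system $$\frac{dP_{11}^\epsilon}{dt}+f(P_{11}^\epsilon,P_{12}^\epsilon,P_{22}^\epsilon,\epsilon)=0,\quad \epsilon\frac{dP_{12}^\epsilon}{dt}+g_1(P_{11}^\epsilon,P_{12}^\epsilon,P_{22}^\epsilon,\epsilon)=0,\quad \epsilon\frac{dP_{22}^\epsilon}{dt}+g_2(P_{11}^\epsilon,P_{12}^\epsilon,P_{22}^\epsilon,\epsilon)=0,$$ with $P_{11}^\epsilon(T)=0$, $P_{12}^\epsilon(T)=0$, $P_{22}^\epsilon(T)=0$, admits a unique solution $(P_{11}^\epsilon,P_{12}^\epsilon,P_{22}^\epsilon)\in C([0,T];\mathbb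 S^{n_1})\times C([0,T];\mathbb R^{n_1\times n_2})\times C([0,T];\mathbb S^{n_2})$, which satisfies, uniformly in $t\in[0,T]$, $$P_{11}^\epsilon(t)-\overline P_{11}(t)=O(\epsilon),\quad P_{12}^\epsilon(t)-\overline P_{12}(t)-\widehat P_{12}\Big(\frac{T-t}{\epsilon}\Big)=O(\epsilon),\quad P_{22}^\epsilon(t)-\overline P_{22}-\widehat P_{22}\Big(\frac{T-t}{\epsilon}\Big)=O(\epsilon),$$ where $\overline P_{12}(t)=-\big(A_{21}^*\overline P_{22}+\overline P_{11}(t)A_{12}+\overline P_{11}(t)\Delta\overline P_{22}\big)(A_{22}+\Delta_2\overline P_{22})^{-1}$ and $(\widehat P_{12}(\tau),\widehat P_{22}(\tau))$, $\tau\ge0$, is the solution of the boundary-layer system.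
   Context: Notation: $M^*$ is the transpose of $M$; $\mathbb S^m$ is the space of symmetric $m\times m$ real matrices; matrices carry the inner product $\langle M,N\rangle=\mathrm{tr}(M^*N)$ and norm $|M|=\langle M,M\rangle^{1/2}$. $O(\epsilon)$ denotes a quantity bounded in norm by $C\epsilon$ for all $0<\epsilon<\epsilon^*$, with $C$ independent of $\epsilon$ and $t$. Data: $n_1,n_2,k_1,k_2\ge1$ are integers; for $i,j\in\{1,2\}$, $A_{ij}\in\mathbb R^{n_i\times n_j}$, $B_{ij}\in\mathbb R^{n_i\times k_j}$, $Q_i\in\mathbb S^{n_i}$ are constant matrices. The perturbation parameter satisfies $0<\epsilon\le1$. Put $\Delta_1=B_{11}B_{11}^*-B_{12}B_{12}^*$, $\Delta=B_{11}B_{21}^*-B_{12}B_{22}^*$, $\Delta_2=B_{21}B_{21}^*-B_{22}B_{22}^*$. Functions of the full system: $f(P_{11},P_{12},P_{22},\epsilon)=A_{11}^*P_{11}+A_{21}^*P_{12}^*+P_{11}A_{11}+P_{12}A_{21}+P_{11}\Delta_1P_{11}+P_{12}\Delta^*P_{11}+P_{11}\Delta P_{12}^*+P_{12}\Delta_2P_{12}^*+Q_1$; $g_1(P_{11},P_{12},P_{22},\epsilon)=\epsilon A_{11}^*P_{12}+A_{21}^*P_{22}+P_{11}A_{12}+P_{12}A_{22}+\epsilon P_{11}\Delta_1P_{12}+\epsilon P_{12}\Delta^*P_{12}+P_{11}\Delta P_{22}+P_{12}\Delta_2P_{22}$; $g_2(P_{11},P_{12},P_{22},\epsilon)=\epsilon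 A_{12}^*P_{12}+A_{22}^*P_{22}+\epsilon P_{12}^*A_{12}+P_{22}A_{22}+\epsilon^2P_{12}^*\Delta_1P_{12}+\epsilon P_{12}^*\Delta P_{22}+\epsilon P_{22}\Delta^*P_{12}+P_{22}\Delta_2P_{22}+Q_2$. Coefficients of the reduced differential Riccati equation: with $\Lambda=A_{22}^*\Delta_2^{-1}A_{22}-Q_2$ (which is invertible under (i) and (ii)), $\widetilde A=A_{11}-\Delta\Delta_2^{-1}[\Delta_2-A_{22}\Lambda^{-1}A_{22}^*]\Delta_2^{-1}A_{21}-A_{12}\Lambda^{-1}A_{22}^*\Delta_2^{-1}A_{21}$; $M=\Delta_1+A_{12}\Lambda^{-1}A_{12}^*-\Delta\Delta_2^{-1}A_{22}\Lambda^{-1}A_{12}^*-A_{12}\Lambda^{-1}A_{22}^*\Delta_2^{-1}\Delta^*-\Delta\Delta_2^{-1}[\Delta_2-A_{22}\Lambda^{-1}A_{22}^*]\Delta_2^{-1}\Delta^*$; $N=Q_1-A_{21}^*\Delta_2^{-1}[\Delta_2-A_{22}\Lambda^{-1}A_{22}^*]\Delta_2^{-1}A_{21}$. For $0<\delta<\gamma$ let $\mathcal R_\delta=\{P\in\mathbb S^{n_2}:\frac12[(S+\Delta_2P)^*+(S+\Delta_2P)]\le\delta I\}$; $B_{\delta,q_2}$ is the largest closed ball centred at $0$ in $\mathbb S^{n_2}$ contained in $\mathcal R_\delta$, and $q_2$ is its radius. Boundary-layer system: with $h(P_{11})=-(A_{21}^*\overline P_{22}+P_{11}A_{12}+P_{11}\Delta\overline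 P_{22})(A_{22}+\Delta_2\overline P_{22})^{-1}$ for $P_{11}\in\mathbb S^{n_1}$, it is $\frac{d\widehat P_{12}}{d\tau}=g_1(0,\widehat P_{12}+h(0),\widehat P_{22}+\overline P_{22},0)$, $\widehat P_{12}(0)=-h(0)$; $\frac{d\widehat P_{22}}{d\tau}=g_2(0,\widehat P_{12}+h(0),\widehat P_{22}+\overline P_{22},0)$, $\widehat P_{22}(0)=-\overline P_{22}$. *)

theory Defs
  imports "HOL-Analysis.Analysis"
begin

text \<open>
  An \<open>m \<times> n\<close> real matrix has type \<open>real ^ 'n ^ 'm\<close>, so the dimensions
  \<open>n\<^sub>1, n\<^sub>2, k\<^sub>1, k\<^sub>2 \<ge> 1\<close> are the cardinalities of the finite types
  \<open>'n1, 'n2, 'k1, 'k2\<close>. The library norm on this type is the norm of the inner product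
  \<open>tr (M\<^sup>* N)\<close>; see \<open>inner_matrix_eq_trace\<close> and \<open>norm_matrix_eq_sqrt_trace\<close> below.
\<close>

notation transpose (\<open>(_\<^sup>\<top>)\<close> [1000] 999)

lemma inner_matrix_eq_trace:
  fixes M N :: "real ^ 'n::finite ^ 'm::finite"
  shows "M \<bullet> N = trace (M\<^sup>\<top> ** N)"
  unfolding inner_vec_def trace_def matrix_matrix_mult_def transpose_def
  by (simp, rule sum.swap)

lemma norm_matrix_eq_sqrt_trace:
  fixes M :: "real ^ 'n::finite ^ 'm::finite"
  shows "norm M = sqrt (trace (M\<^sup>\<top> ** M))"
  by (simp add: norm_eq_sqrt_inner inner_matrix_eq_trace)

definition Sym :: "(real ^ 'n::finite ^ 'n) set" where
  "Sym = {M. M\<^sup>\<top> = M}"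

text \<open>Symmetry is not part of this relation; it is only used between symmetric matrices.\<close>

definition loewner_le :: "real ^ 'n::finite ^ 'n \<Rightarrow> real ^ 'n ^ 'n \<Rightarrow> bool" (infix \<open>\<preceq>\<close> 50) where
  "M \<preceq> N \<longleftrightarrow> (\<forall>x. 0 \<le> x \<bullet> ((N - M) *v x))"

definition sym_part :: "real ^ 'n::finite ^ 'n \<Rightarrow> real ^ 'n ^ 'n" where
  "sym_part M = (1/2) *\<^sub>R (M\<^sup>\<top> + M)"

definition is_eigenvalue :: "real ^ 'n::finite ^ 'n \<Rightarrow> complex \<Rightarrow> bool" where
  "is_eigenvalue M z \<longleftrightarrow>
     (\<exists>v :: complex ^ 'n. v \<noteq> 0 \<and> map_matrix complex_of_real M *v v = z *s v)"

record ('n1, 'n2, 'k1, 'k2) riccati_data =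
  A11 :: "real ^ 'n1 ^ 'n1"
  A12 :: "real ^ 'n2 ^ 'n1"
  A21 :: "real ^ 'n1 ^ 'n2"
  A22 :: "real ^ 'n2 ^ 'n2"
  B11 :: "real ^ 'k1 ^ 'n1"
  B12 :: "real ^ 'k2 ^ 'n1"
  B21 :: "real ^ 'k1 ^ 'n2"
  B22 :: "real ^ 'k2 ^ 'n2"
  Q1 :: "real ^ 'n1 ^ 'n1"
  Q2 :: "real ^ 'n2 ^ 'n2"

definition Delta1 :: "('n1::finite, 'n2::finite, 'k1::finite, 'k2::finite) riccati_data \<Rightarrow> real ^ 'n1 ^ 'n1" where
  "Delta1 D = B11 D ** (B11 D)\<^sup>\<top> - B12 D ** (B12 D)\<^sup>\<top>"

definition Delta :: "('n1::finite, 'n2::finite, 'k1::finite, 'k2::finite) riccati_data \<Rightarrow> real ^ 'n2 ^ 'n1" where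
  "Delta D = B11 D ** (B21 D)\<^sup>\<top> - B12 D ** (B22 D)\<^sup>\<top>"

definition Delta2 :: "('n1::finite, 'n2::finite, 'k1::finite, 'k2::finite) riccati_data \<Rightarrow> real ^ 'n2 ^ 'n2" where
  "Delta2 D = B21 D ** (B21 D)\<^sup>\<top> - B22 D ** (B22 D)\<^sup>\<top>"

text \<open>
  The functions of the full system; \<open>f\<close> does not depend on \<open>P22\<close> and \<open>e\<close>, which are kept
  so that all three have the same arguments.
\<close>

definition f :: "('n1::finite, 'n2::finite, 'k1::finite, 'k2::finite) riccati_data
    \<Rightarrow> real ^ 'n1 ^ 'n1 \<Rightarrow> real ^ 'n2 ^ 'n1 \<Rightarrow> real ^ 'n2 ^ 'n2 \<Rightarrow> real \<Rightarrow> real ^ 'n1 ^ 'n1" where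
  "f D P11 P12 P22 e =
     (A11 D)\<^sup>\<top> ** P11 + (A21 D)\<^sup>\<top> ** P12\<^sup>\<top> + P11 ** A11 D + P12 ** A21 D
     + P11 ** Delta1 D ** P11 + P12 ** (Delta D)\<^sup>\<top> ** P11
     + P11 ** Delta D ** P12\<^sup>\<top> + P12 ** Delta2 D ** P12\<^sup>\<top> + Q1 D"

definition g1 :: "('n1::finite, 'n2::finite, 'k1::finite, 'k2::finite) riccati_data
    \<Rightarrow> real ^ 'n1 ^ 'n1 \<Rightarrow> real ^ 'n2 ^ 'n1 \<Rightarrow> real ^ 'n2 ^ 'n2 \<Rightarrow> real \<Rightarrow> real ^ 'n2 ^ 'n1" where
  "g1 D P11 P12 P22 e =
     e *\<^sub>R ((A11 D)\<^sup>\<top> ** P12) + (A21 D)\<^sup>\<top> ** P22 + P11 ** A12 D + P12 ** A22 D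
     + e *\<^sub>R (P11 ** Delta1 D ** P12) + e *\<^sub>R (P12 ** (Delta D)\<^sup>\<top> ** P12)
     + P11 ** Delta D ** P22 + P12 ** Delta2 D ** P22"

definition g2 :: "('n1::finite, 'n2::finite, 'k1::finite, 'k2::finite) riccati_data
    \<Rightarrow> real ^ 'n1 ^ 'n1 \<Rightarrow> real ^ 'n2 ^ 'n1 \<Rightarrow> real ^ 'n2 ^ 'n2 \<Rightarrow> real \<Rightarrow> real ^ 'n2 ^ 'n2" where
  "g2 D P11 P12 P22 e =
     e *\<^sub>R ((A12 D)\<^sup>\<top> ** P12) + (A22 D)\<^sup>\<top> ** P22 + e *\<^sub>R (P12\<^sup>\<top> ** A12 D) + P22 ** A22 D
     + e\<^sup>2 *\<^sub>R (P12\<^sup>\<top> ** Delta1 D ** P12) + e *\<^sub>R (P12\<^sup>\<top> ** Delta D ** P22)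
     + e *\<^sub>R (P22 ** (Delta D)\<^sup>\<top> ** P12) + P22 ** Delta2 D ** P22 + Q2 D"

text \<open>
  Solutions on \<open>[0,T]\<close> are functions on \<open>real\<close> of which only the values on \<open>[0,T]\<close> matter;
  the derivatives at the end points are one-sided.
\<close>

definition full_solution :: "('n1::finite, 'n2::finite, 'k1::finite, 'k2::finite) riccati_data
    \<Rightarrow> real \<Rightarrow> real \<Rightarrow> (real \<Rightarrow> real ^ 'n1 ^ 'n1) \<Rightarrow> (real \<Rightarrow> real ^ 'n2 ^ 'n1)
    \<Rightarrow> (real \<Rightarrow> real ^ 'n2 ^ 'n2) \<Rightarrow> bool" where
  "full_solution D T e P11 P12 P22 \<longleftrightarrow>
     continuous_on {0..T} P11 \<and> continuous_on {0..T} P12 \<and> continuous_on {0..T} P22 \<and>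
     P11 ` {0..T} \<subseteq> Sym \<and> P22 ` {0..T} \<subseteq> Sym \<and>
     (\<forall>t\<in>{0..T}. \<exists>P11' P12' P22'.
        (P11 has_vector_derivative P11') (at t within {0..T}) \<and>
        (P12 has_vector_derivative P12') (at t within {0..T}) \<and>
        (P22 has_vector_derivative P22') (at t within {0..T}) \<and>
        P11' + f D (P11 t) (P12 t) (P22 t) e = 0 \<and>
        e *\<^sub>R P12' + g1 D (P11 t) (P12 t) (P22 t) e = 0 \<and>
        e *\<^sub>R P22' + g2 D (P11 t) (P12 t) (P22 t) e = 0) \<and>
     P11 T = 0 \<and> P12 T = 0 \<and> P22 T = 0"

text \<open>
  \<open>matrix_inv\<close> is the inverse only for invertible arguments. Below it is applied to \<open>Delta2 D\<close>,
  to \<open>Smat D Pbar22\<close> and to \<open>Lambda D\<close>; if \<open>Pbar22\<close> is a symmetric solution of the algebraic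
  Riccati equation, then \<open>Lambda D = S\<^sup>* \<Delta>\<^sub>2\<^sup>-\<^sup>1 S\<close> with \<open>S = Smat D Pbar22\<close>.
\<close>

definition Lambda :: "('n1::finite, 'n2::finite, 'k1::finite, 'k2::finite) riccati_data \<Rightarrow> real ^ 'n2 ^ 'n2" where
  "Lambda D = (A22 D)\<^sup>\<top> ** matrix_inv (Delta2 D) ** A22 D - Q2 D"

definition Atilde :: "('n1::finite, 'n2::finite, 'k1::finite, 'k2::finite) riccati_data \<Rightarrow> real ^ 'n1 ^ 'n1" where
  "Atilde D = A11 D
     - Delta D ** matrix_inv (Delta2 D)
         ** (Delta2 D - A22 D ** matrix_inv (Lambda D) ** (A22 D)\<^sup>\<top>)
         ** matrix_inv (Delta2 D) ** A21 D
     - A12 D ** matrix_inv (Lambda D) ** (A22 D)\<^sup>\<top> ** matrix_inv (Delta2 D) ** A21 D"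

definition Mmat :: "('n1::finite, 'n2::finite, 'k1::finite, 'k2::finite) riccati_data \<Rightarrow> real ^ 'n1 ^ 'n1" where
  "Mmat D = Delta1 D
     + A12 D ** matrix_inv (Lambda D) ** (A12 D)\<^sup>\<top>
     - Delta D ** matrix_inv (Delta2 D) ** A22 D ** matrix_inv (Lambda D) ** (A12 D)\<^sup>\<top>
     - A12 D ** matrix_inv (Lambda D) ** (A22 D)\<^sup>\<top> ** matrix_inv (Delta2 D) ** (Delta D)\<^sup>\<top>
     - Delta D ** matrix_inv (Delta2 D)
         ** (Delta2 D - A22 D ** matrix_inv (Lambda D) ** (A22 D)\<^sup>\<top>)
         ** matrix_inv (Delta2 D) ** (Delta D)\<^sup>\<top>"

definition Nmat :: "('n1::finite, 'n2::finite, 'k1::finite, 'k2::finite) riccati_data \<Rightarrow> real ^ 'n1 ^ 'n1" where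
  "Nmat D = Q1 D
     - (A21 D)\<^sup>\<top> ** matrix_inv (Delta2 D)
         ** (Delta2 D - A22 D ** matrix_inv (Lambda D) ** (A22 D)\<^sup>\<top>)
         ** matrix_inv (Delta2 D) ** A21 D"

definition reduced_solution :: "('n1::finite, 'n2::finite, 'k1::finite, 'k2::finite) riccati_data
    \<Rightarrow> real \<Rightarrow> (real \<Rightarrow> real ^ 'n1 ^ 'n1) \<Rightarrow> bool" where
  "reduced_solution D T P \<longleftrightarrow>
     continuous_on {0..T} P \<and> P ` {0..T} \<subseteq> Sym \<and>
     (\<forall>t\<in>{0..T}. \<exists>P'. (P has_vector_derivative P') (at t within {0..T}) \<and>
        P' + (Atilde D)\<^sup>\<top> ** P t + P t ** Atilde D + P t ** Mmat D ** P t + Nmat D = 0) \<and>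
     P T = 0"

definition Smat :: "('n1::finite, 'n2::finite, 'k1::finite, 'k2::finite) riccati_data
    \<Rightarrow> real ^ 'n2 ^ 'n2 \<Rightarrow> real ^ 'n2 ^ 'n2" where
  "Smat D Pbar22 = A22 D + Delta2 D ** Pbar22"

definition hfun :: "('n1::finite, 'n2::finite, 'k1::finite, 'k2::finite) riccati_data
    \<Rightarrow> real ^ 'n2 ^ 'n2 \<Rightarrow> real ^ 'n1 ^ 'n1 \<Rightarrow> real ^ 'n2 ^ 'n1" where
  "hfun D Pbar22 P11 =
     - (((A21 D)\<^sup>\<top> ** Pbar22 + P11 ** A12 D + P11 ** Delta D ** Pbar22)
        ** matrix_inv (A22 D + Delta2 D ** Pbar22))"

definition region :: "('n1::finite, 'n2::finite, 'k1::finite, 'k2::finite) riccati_data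
    \<Rightarrow> real ^ 'n2 ^ 'n2 \<Rightarrow> real \<Rightarrow> (real ^ 'n2 ^ 'n2) set" where
  "region D Pbar22 d =
     {P \<in> Sym. sym_part (Smat D Pbar22 + Delta2 D ** P) \<preceq> d *\<^sub>R mat 1}"

definition sym_cball :: "real \<Rightarrow> (real ^ 'n::finite ^ 'n) set" where
  "sym_cball r = Sym \<inter> cball 0 r"

definition is_largest_radius :: "('n1::finite, 'n2::finite, 'k1::finite, 'k2::finite) riccati_data
    \<Rightarrow> real ^ 'n2 ^ 'n2 \<Rightarrow> real \<Rightarrow> real \<Rightarrow> bool" where
  "is_largest_radius D Pbar22 d q \<longleftrightarrow>
     0 \<le> q \<and> sym_cball q \<subseteq> region D Pbar22 d \<and>
     (\<forall>r\<ge>0. sym_cball r \<subseteq> region D Pbar22 d \<longrightarrow> r \<le> q)"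

definition boundary_layer_solution :: "('n1::finite, 'n2::finite, 'k1::finite, 'k2::finite) riccati_data
    \<Rightarrow> real ^ 'n2 ^ 'n2 \<Rightarrow> (real \<Rightarrow> real ^ 'n2 ^ 'n1) \<Rightarrow> (real \<Rightarrow> real ^ 'n2 ^ 'n2) \<Rightarrow> bool" where
  "boundary_layer_solution D Pbar22 Phat12 Phat22 \<longleftrightarrow>
     Phat22 ` {0..} \<subseteq> Sym \<and>
     (\<forall>\<tau>\<ge>0.
        (Phat12 has_vector_derivative
           g1 D 0 (Phat12 \<tau> + hfun D Pbar22 0) (Phat22 \<tau> + Pbar22) 0) (at \<tau> within {0..}) \<and>
        (Phat22 has_vector_derivative
           g2 D 0 (Phat12 \<tau> + hfun D Pbar22 0) (Phat22 \<tau> + Pbar22) 0) (at \<tau> within {0..})) \<and>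
     Phat12 0 = - hfun D Pbar22 0 \<and> Phat22 0 = - Pbar22"

end

theory Submission
  imports Defs
begin

text \<open>
  In the reversed time \<open>s = T - t\<close> the full system is an initial value problem for a slow variable \<open>P11\<close> and two fast
  variables \<open>P12\<close>, \<open>P22\<close>, and the claim is a Tikhonov theorem with explicit initial layer: with
  \<open>X s = Pbar11 (T - s)\<close> and the boundary-layer solution \<open>(Y, Z)\<close>, the triple
  \<open>(X s, h (X s) + Y (s / \<epsilon>), Pbar22 + Z (s / \<epsilon>))\<close> satisfies the initial conditions exactly and the equations up to
  terms whose effect is of order \<open>\<epsilon>\<close>. The slow component fits because inserting the quasi-steady state \<open>h P\<close> into the
  slow equation produces the reduced Riccati equation; this is an identity of matrices, \<open>reduced_vector_field\<close>.

  The layer is stable for the following reason. The field of \<open>Z\<close> is \<open>S\<^sup>\<top> Z + Z S + Z \<Delta>\<^sub>2 Z\<close>, the mean of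
  \<open>S\<^sup>\<top> Z + Z S\<close> and \<open>(S + \<Delta>\<^sub>2 Z)\<^sup>\<top> Z + Z (S + \<Delta>\<^sub>2 Z)\<close>. The first contributes dissipation at the rate \<open>\<gamma>\<close>; the second
  contributes growth at a rate of at most \<open>\<delta> < \<gamma>\<close> as long as \<open>Z\<close> is in the ball of radius \<open>q2\<close>. Since
  \<open>Z 0 = - Pbar22\<close> is strictly inside, \<open>Z\<close> remains there and decays exponentially, and \<open>Y\<close>, which solves a linear equation
  driven by \<open>Z\<close>, decays as well (\<open>boundary_layer_exists\<close>).

  For the errors \<open>\<xi>\<close>, \<open>\<eta>\<close>, \<open>\<zeta>\<close> of the three components, the linear parts of the two fast equations are governed by
  \<open>S + \<Delta>\<^sub>2 Z\<close>, which means dissipation at the rate \<open>\<gamma>\<close> up to an exponentially decaying perturbation, which costs a constant factor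
  independent of \<open>\<epsilon>\<close>. The error \<open>\<zeta>\<close> is coupled to the others only through terms of order \<open>\<epsilon>\<close> and is bounded by
  \<open>layer_energy\<close>. The pair \<open>(\<xi>, \<eta>)\<close> is bounded with the energy \<open>\<bar>\<xi>\<bar>\<^sup>2 + \<epsilon> \<bar>\<eta>\<bar>\<^sup>2\<close> in \<open>slow_fast_energy\<close>: the slow equation sees the layer
  \<open>Y\<close> only through its integral over time, which is of order \<open>\<epsilon>\<close>.

  These estimates hold for any solution in a tube of fixed radius around the approximation, and for small \<open>\<epsilon>\<close> they place
  the solution strictly inside the tube (\<open>layer_error_estimate\<close>). By \<open>ode_exists_in_tube\<close> this yields existence on all of
  \<open>[0, T]\<close> together with the error bound. Symmetry of \<open>P11\<close> and \<open>P22\<close> is obtained by solving the equation with symmetrised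
  arguments.
\<close>

section \<open>Calculus of vector-valued functions\<close>

lemma has_vector_derivative_norm_sq:
  fixes u :: "real \<Rightarrow> 'a::real_inner"
  assumes "(u has_vector_derivative u') (at t within S)"
  shows "((\<lambda>t. (norm (u t))\<^sup>2) has_real_derivative 2 * (u t \<bullet> u')) (at t within S)"
proof -
  have "((\<lambda>t. u t \<bullet> u t) has_derivative (\<lambda>h. u t \<bullet> (h *\<^sub>R u') + (h *\<^sub>R u') \<bullet> u t)) (at t within S)"
    using assms unfolding has_vector_derivative_def by (intro has_derivative_inner) auto
  then show ?thesis
    unfolding has_field_derivative_def power2_norm_eq_inner
    by (rule has_derivative_eq_rhs) (auto simp: inner_commute algebra_simps)
qed

lemma has_vector_derivative_fst: "(u has_vector_derivative u') F \<Longrightarrow> ((\<lambda>s. fst (u s)) has_vector_derivative fst u') F"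
  by (rule bounded_linear.has_vector_derivative[OF bounded_linear_fst])

lemma has_vector_derivative_snd: "(u has_vector_derivative u') F \<Longrightarrow> ((\<lambda>s. snd (u s)) has_vector_derivative snd u') F"
  by (rule bounded_linear.has_vector_derivative[OF bounded_linear_snd])

lemma has_vector_derivative_Icc_imp_Ici:
  assumes "(u has_vector_derivative u') (at s within {0..s + 1})" "0 \<le> (s::real)"
  shows "(u has_vector_derivative u') (at s within {0..})"
proof -
  have "at s within {0..s + 1} = at s within {0..}"
    by (rule at_within_nhd[of s "{..<s + 1}"]) auto
  then show ?thesis using assms by simp
qed

lemma reverse_time_derivative:
  fixes u :: "real \<Rightarrow> 'a::real_normed_vector"
  assumes "(u has_vector_derivative u') (at (T - s) within {0..T})" "s \<in> {0..T}"
  shows "((\<lambda>s. u (T - s)) has_vector_derivative - u') (at s within {0..T})"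
proof -
  have "((\<lambda>s. T - s) has_vector_derivative - 1) (at s within {0..T})"
    unfolding has_real_derivative_iff_has_vector_derivative[symmetric]
    by (auto intro!: derivative_eq_intros)
  moreover have "(u has_vector_derivative u') (at (T - s) within (\<lambda>s. T - s) ` {0..T})"
    by (rule has_vector_derivative_within_subset[OF assms(1)]) auto
  ultimately show ?thesis
    using vector_diff_chain_within[of "\<lambda>s. T - s" "- 1" s "{0..T}" u u'] by (simp add: o_def)
qed

lemma layer_time_derivative:
  fixes Y :: "real \<Rightarrow> 'a::real_normed_vector"
  assumes Y: "\<And>\<tau>. 0 \<le> \<tau> \<Longrightarrow> (Y has_vector_derivative Y' \<tau>) (at \<tau> within {0..})"
    and "0 < e" "s \<in> {0..t}"
  shows "((\<lambda>s. Y (s / e)) has_vector_derivative (1 / e) *\<^sub>R Y' (s / e)) (at s within {0..t})"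
proof -
  have "((\<lambda>s. s / e) has_vector_derivative 1 / e) (at s within {0..t})"
    unfolding has_real_derivative_iff_has_vector_derivative[symmetric]
    using \<open>0 < e\<close> by (auto intro!: derivative_eq_intros)
  moreover have "(Y has_vector_derivative Y' (s / e)) (at (s / e) within (\<lambda>s. s / e) ` {0..t})"
    using assms by (intro has_vector_derivative_within_subset[OF Y]) auto
  ultimately show ?thesis
    using vector_diff_chain_within[of "\<lambda>s. s / e" "1 / e" s "{0..t}" Y "Y' (s / e)"] by (simp add: o_def)
qed

lemma norm_le_linear_growth:
  fixes X :: "real \<Rightarrow> 'a::real_normed_vector"
  assumes X: "\<And>s. s \<in> {0..T} \<Longrightarrow> (X has_vector_derivative X' s) (at s within {0..T})"
    and B: "\<And>s. s \<in> {0..T} \<Longrightarrow> norm (X' s) \<le> B" and "X 0 = 0" and s: "s \<in> {0..T}"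
  shows "norm (X s) \<le> B * s"
proof -
  have "0 \<le> B" using B[OF s] norm_ge_zero[of "X' s"] by linarith
  have "norm (X s - X 0) \<le> B * norm (s - 0)"
  proof (rule differentiable_bound[where S = "{0..T}" and f' = "\<lambda>s h. h *\<^sub>R X' s"])
    fix r assume r: "r \<in> {0..T}"
    show "(X has_derivative (\<lambda>h. h *\<^sub>R X' r)) (at r within {0..T})"
      using X[OF r] by (simp add: has_vector_derivative_def)
    show "onorm (\<lambda>h. h *\<^sub>R X' r) \<le> B"
      using B[OF r] \<open>0 \<le> B\<close> by (intro onorm_bound) (auto simp: mult.commute[of B] intro: mult_left_mono)
  qed (use s in auto)
  then show ?thesis using s \<open>X 0 = 0\<close> by simp
qed

lemma norm_triple:
  fixes p :: "'a::real_normed_vector \<times> 'b::real_normed_vector \<times> 'c::real_normed_vector"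
  shows "norm (fst p) \<le> norm p" "norm (fst (snd p)) \<le> norm p" "norm (snd (snd p)) \<le> norm p"
    "norm p \<le> norm (fst p) + norm (fst (snd p)) + norm (snd (snd p))"
proof -
  obtain x y z where p: "p = (x, y, z)" using prod_cases3 by blast
  show "norm (fst p) \<le> norm p" by (simp add: p norm_fst_le)
  have "norm (y, z) \<le> norm p" by (simp add: p norm_snd_le)
  then show "norm (fst (snd p)) \<le> norm p" "norm (snd (snd p)) \<le> norm p"
    using norm_fst_le[of y z] norm_snd_le[of z y] by (auto simp: p intro: order_trans)
  show "norm p \<le> norm (fst p) + norm (fst (snd p)) + norm (snd (snd p))"
    using norm_Pair_le[of x "(y, z)"] norm_Pair_le[of y z] by (simp add: p)
qed

lemma inner_le_norms: "norm b \<le> B \<Longrightarrow> a \<bullet> b \<le> norm a * B"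
  by (meson mult_left_mono norm_cauchy_schwarz norm_ge_zero order_trans)

text \<open>
  The rate \<open>p\<close> and the source \<open>q\<close> enter through antiderivatives \<open>P\<close> and \<open>Q\<close>, because the rates used below are
  large in a short initial layer while \<open>P\<close> stays bounded.
\<close>

lemma gronwall_differential:
  fixes \<Phi> \<Phi>' P p Q q :: "real \<Rightarrow> real"
  assumes "0 \<le> t"
    and \<Phi>: "\<And>s. s \<in> {0..t} \<Longrightarrow> (\<Phi> has_real_derivative \<Phi>' s) (at s within {0..t})"
    and P: "\<And>s. s \<in> {0..t} \<Longrightarrow> (P has_real_derivative p s) (at s within {0..t})"
    and Q: "\<And>s. s \<in> {0..t} \<Longrightarrow> (Q has_real_derivative q s) (at s within {0..t})"
    and P_nonneg: "P 0 = 0" "\<And>s. s \<in> {0..t} \<Longrightarrow> 0 \<le> P s"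
    and q_nonneg: "Q 0 = 0" "\<And>s. s \<in> {0..t} \<Longrightarrow> 0 \<le> q s"
    and le: "\<And>s. s \<in> {0..t} \<Longrightarrow> \<Phi>' s \<le> p s * \<Phi> s + q s"
  shows "\<Phi> t \<le> exp (P t) * (\<Phi> 0 + Q t)"
proof -
  \<comment> \<open>\<open>G\<close> is nonincreasing: the integrating factor removes \<open>p\<close>, and
    \<open>exp (- P) \<le> 1\<close> lets \<open>q\<close> be kept without a weight.\<close>
  define G where "G s = \<Phi> s * exp (- P s) - Q s" for s
  define G' where "G' s = exp (- P s) * (\<Phi>' s - p s * \<Phi> s) - q s" for s
  have G: "(G has_real_derivative G' s) (at s within {0..t})" if "s \<in> {0..t}" for s
    unfolding G_def G'_def
    by (rule derivative_eq_intros \<Phi>[OF that] P[OF that] Q[OF that] refl)+ (simp add: algebra_simps)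
  have G'_nonpos: "G' s \<le> 0" if s: "s \<in> {0..t}" for s
  proof -
    have "exp (- P s) * (\<Phi>' s - p s * \<Phi> s) \<le> exp (- P s) * q s"
      using le[OF s] by (intro mult_left_mono) auto
    also have "\<dots> \<le> 1 * q s"
      using P_nonneg(2)[OF s] q_nonneg(2)[OF s] by (intro mult_right_mono) auto
    finally show ?thesis by (simp add: G'_def)
  qed
  have "G t \<le> G 0"
  proof -
    obtain x where x: "x \<in> {0..t}" "G t - G 0 = (t - 0) * G' x"
      using mvt_very_simple[OF \<open>0 \<le> t\<close>, of G "\<lambda>s h. h * G' s"] G
      by (auto simp: has_field_derivative_def mult.commute[of _ "G' _"])
    then show ?thesis
      using G'_nonpos[OF x(1)] \<open>0 \<le> t\<close> mult_nonneg_nonpos[of t "G' x"] by auto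
  qed
  then have "\<Phi> t * exp (- P t) \<le> \<Phi> 0 + Q t"
    using P_nonneg q_nonneg by (simp add: G_def)
  then have "exp (P t) * (\<Phi> t * exp (- P t)) \<le> exp (P t) * (\<Phi> 0 + Q t)"
    by (intro mult_left_mono) auto
  then show ?thesis
    by (simp add: exp_minus field_simps)
qed

section \<open>Vector fields that are Lipschitz continuous on balls\<close>

text \<open>
  One Lipschitz constant for every ball. The property passes to compositions and to bounded bilinear products, so
  that for the functions of the full system it follows from their formulas, and it implies boundedness on balls
  without any appeal to compactness.
\<close>

definition lipschitz_on_balls :: "('a::real_normed_vector \<Rightarrow> 'b::real_normed_vector) \<Rightarrow> bool" where
  "lipschitz_on_balls F \<longleftrightarrow> (\<forall>R. \<exists>L. L-lipschitz_on (cball 0 R) F)"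

lemma lipschitz_on_ballsE:
  assumes "lipschitz_on_balls F"
  obtains L where "0 < L" "\<And>x y. norm x \<le> R \<Longrightarrow> norm y \<le> R \<Longrightarrow> norm (F x - F y) \<le> L * norm (x - y)"
proof -
  obtain M where M: "M-lipschitz_on (cball 0 R) F"
    using assms unfolding lipschitz_on_balls_def by blast
  have "norm (F x - F y) \<le> (\<bar>M\<bar> + 1) * norm (x - y)" if "norm x \<le> R" "norm y \<le> R" for x y
  proof -
    have "norm (F x - F y) \<le> M * norm (x - y)"
      using lipschitz_on_normD[OF M] that by auto
    also have "\<dots> \<le> (\<bar>M\<bar> + 1) * norm (x - y)"
      by (intro mult_right_mono) auto
    finally show ?thesis .
  qed
  then show ?thesis using that[of "\<bar>M\<bar> + 1"] by auto
qed

lemma lipschitz_on_balls_bounded: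
  assumes "lipschitz_on_balls F"
  obtains B where "0 < B" "\<And>x. norm x \<le> R \<Longrightarrow> norm (F x) \<le> B"
proof -
  obtain L where L: "0 < L" "\<And>x y. norm x \<le> R \<Longrightarrow> norm y \<le> R \<Longrightarrow> norm (F x - F y) \<le> L * norm (x - y)"
    using lipschitz_on_ballsE[OF assms, of R] by blast
  have "norm (F x) \<le> norm (F 0) + L * \<bar>R\<bar> + 1" if x: "norm x \<le> R" for x
  proof -
    have "0 \<le> R" using norm_ge_zero[of x] x by linarith
    then have "norm (F x - F 0) \<le> L * norm x" using L(2)[of x 0] x by simp
    also have "\<dots> \<le> L * \<bar>R\<bar>" using x L(1) by (intro mult_left_mono) auto
    finally show ?thesis
      using norm_triangle_sub[of "F x" "F 0"] by linarith
  qed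
  then show ?thesis using L(1) by (intro that[of "norm (F 0) + L * \<bar>R\<bar> + 1"])
    (auto simp: add_nonneg_pos)
qed

named_theorems lipschitz_on_balls_intros

lemma lipschitz_on_balls_const [lipschitz_on_balls_intros]: "lipschitz_on_balls (\<lambda>x. c)"
  unfolding lipschitz_on_balls_def by (auto intro: lipschitz_on_constant)

lemma lipschitz_on_balls_bounded_linear:
  assumes "bounded_linear h"
  shows "lipschitz_on_balls h"
  unfolding lipschitz_on_balls_def
  using bounded_linear.lipschitz_boundE[OF assms] by metis

lemma lipschitz_on_balls_compose:
  assumes G: "lipschitz_on_balls G" and F: "lipschitz_on_balls F"
  shows "lipschitz_on_balls (\<lambda>x. G (F x))"
  unfolding lipschitz_on_balls_def
proof
  fix R
  obtain B where B: "\<And>x. norm x \<le> R \<Longrightarrow> norm (F x) \<le> B"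
    using lipschitz_on_balls_bounded[OF F, of R] by blast
  obtain M where M: "M-lipschitz_on (cball 0 B) G" using G unfolding lipschitz_on_balls_def by blast
  obtain L where L: "L-lipschitz_on (cball 0 R) F" using F unfolding lipschitz_on_balls_def by blast
  have "M-lipschitz_on (F ` cball 0 R) G"
    using B by (intro lipschitz_on_subset[OF M]) auto
  then show "\<exists>L. L-lipschitz_on (cball 0 R) (\<lambda>x. G (F x))"
    using lipschitz_on_compose2[OF L] by blast
qed

lemma lipschitz_on_balls_ident [lipschitz_on_balls_intros]: "lipschitz_on_balls (\<lambda>x. x)"
  by (intro lipschitz_on_balls_bounded_linear bounded_linear_ident)

lemma lipschitz_on_balls_linear_compose:
  assumes "bounded_linear h" "lipschitz_on_balls F"
  shows "lipschitz_on_balls (\<lambda>x. h (F x))"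
  using lipschitz_on_balls_compose[OF lipschitz_on_balls_bounded_linear[OF assms(1)] assms(2)] .

lemmas lipschitz_on_balls_fst [lipschitz_on_balls_intros] = lipschitz_on_balls_linear_compose[OF bounded_linear_fst]

lemmas lipschitz_on_balls_snd [lipschitz_on_balls_intros] = lipschitz_on_balls_linear_compose[OF bounded_linear_snd]

lemma lipschitz_on_balls_add [lipschitz_on_balls_intros]:
  assumes "lipschitz_on_balls F" "lipschitz_on_balls G"
  shows "lipschitz_on_balls (\<lambda>x. F x + G x)"
  using assms unfolding lipschitz_on_balls_def by (blast intro: lipschitz_on_add)

lemma lipschitz_on_balls_Pair [lipschitz_on_balls_intros]:
  assumes "lipschitz_on_balls F" "lipschitz_on_balls G"
  shows "lipschitz_on_balls (\<lambda>x. (F x, G x))"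
  using assms unfolding lipschitz_on_balls_def by (blast intro: lipschitz_on_Pair)

lemma lipschitz_on_balls_bilinear:
  fixes F :: "'a::real_normed_vector \<Rightarrow> 'b::real_normed_vector" and G :: "'a \<Rightarrow> 'c::real_normed_vector"
  assumes "bounded_bilinear b" and F: "lipschitz_on_balls F" and G: "lipschitz_on_balls G"
  shows "lipschitz_on_balls (\<lambda>x. b (F x) (G x))"
  unfolding lipschitz_on_balls_def
proof
  fix R :: real
  interpret bounded_bilinear b by fact
  obtain K where K: "0 < K" "\<And>x y. norm (b x y) \<le> norm x * norm y * K"
    using pos_bounded by blast
  obtain A where A: "0 < A" "\<And>x. norm x \<le> R \<Longrightarrow> norm (F x) \<le> A"
    using lipschitz_on_balls_bounded[OF F, of R] by blast
  obtain B where B: "0 < B" "\<And>x. norm x \<le> R \<Longrightarrow> norm (G x) \<le> B"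
    using lipschitz_on_balls_bounded[OF G, of R] by blast
  obtain L where L: "0 < L" "\<And>x y. norm x \<le> R \<Longrightarrow> norm y \<le> R \<Longrightarrow> norm (F x - F y) \<le> L * norm (x - y)"
    using lipschitz_on_ballsE[OF F, of R] by blast
  obtain M where M: "0 < M" "\<And>x y. norm x \<le> R \<Longrightarrow> norm y \<le> R \<Longrightarrow> norm (G x - G y) \<le> M * norm (x - y)"
    using lipschitz_on_ballsE[OF G, of R] by blast
  have "(K * (L * B + A * M))-lipschitz_on (cball 0 R) (\<lambda>x. b (F x) (G x))"
  proof (rule lipschitz_onI)
    fix x y :: 'a assume "x \<in> cball 0 R" "y \<in> cball 0 R"
    then have x: "norm x \<le> R" and y: "norm y \<le> R" by auto
    have "b (F x) (G x) - b (F y) (G y) = b (F x - F y) (G x) + b (F y) (G x - G y)"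
      by (simp add: diff_left diff_right)
    also have "norm \<dots> \<le> norm (F x - F y) * norm (G x) * K + norm (F y) * norm (G x - G y) * K"
      by (intro norm_triangle_le add_mono K)
    also have "\<dots> \<le> (L * norm (x - y)) * B * K + A * (M * norm (x - y)) * K"
      using x y L M A B K by (intro add_mono mult_right_mono mult_mono) auto
    finally show "dist (b (F x) (G x)) (b (F y) (G y)) \<le> K * (L * B + A * M) * dist x y"
      by (simp add: dist_norm algebra_simps)
  qed (use K A B L M in auto)
  then show "\<exists>L. L-lipschitz_on (cball 0 R) (\<lambda>x. b (F x) (G x))" by blast
qed

lemmas lipschitz_on_balls_scaleR [lipschitz_on_balls_intros] = lipschitz_on_balls_bilinear[OF bounded_bilinear_scaleR]

lemma lipschitz_on_balls_mult_real: "lipschitz_on_balls F \<Longrightarrow> lipschitz_on_balls G \<Longrightarrow> lipschitz_on_balls (\<lambda>x. F x * G x :: real)"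
  by (rule lipschitz_on_balls_bilinear[OF bounded_bilinear_mult])

section \<open>Existence and uniqueness for autonomous differential equations\<close>

definition ode_on :: "('a::real_normed_vector \<Rightarrow> 'a) \<Rightarrow> real \<Rightarrow> (real \<Rightarrow> 'a) \<Rightarrow> bool" where
  "ode_on F T u \<longleftrightarrow> (\<forall>t\<in>{0..T}. (u has_vector_derivative F (u t)) (at t within {0..T}))"

lemma ode_onD: "ode_on F T u \<Longrightarrow> t \<in> {0..T} \<Longrightarrow> (u has_vector_derivative F (u t)) (at t within {0..T})"
  by (simp add: ode_on_def)

lemma ode_on_subset: "ode_on F T u \<Longrightarrow> s \<le> T \<Longrightarrow> ode_on F s u"
  unfolding ode_on_def by (force intro: has_vector_derivative_within_subset[of _ _ _ "{0..T}"])

lemma ode_on_continuous: "ode_on F T u \<Longrightarrow> continuous_on {0..T} u"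
  unfolding continuous_on_eq_continuous_within
  using ode_onD has_vector_derivative_continuous by blast

text \<open>
  Global Lipschitz continuity lets the Picard iteration converge on the whole interval at once; it is applied to
  vector fields that have been cut off outside a ball.
\<close>

lemma picard_lindelof_global:
  fixes F :: "'a::euclidean_space \<Rightarrow> 'a"
  assumes lip: "L-lipschitz_on UNIV F" and "0 \<le> T"
  obtains u where "u 0 = u0" "ode_on F T u"
proof -
  \<comment> \<open>Adding 1 makes the constant positive, so that \<open>exp (2 * l * t)\<close> grows at a
    positive rate.\<close>
  define l where "l = L + 1"
  have "0 < l" using lipschitz_on_nonneg[OF lip] by (simp add: l_def)
  have Flip: "norm (F x - F y) \<le> l * norm (x - y)" for x y
    using lipschitz_on_normD[OF lip, of x y] by (simp add: l_def distrib_right add_increasing2)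
  have Fcont: "continuous_on A F" for A
    using lipschitz_on_continuous_on[OF lip] continuous_on_subset by blast
  define u :: "nat \<Rightarrow> real \<Rightarrow> 'a" where "u = rec_nat (\<lambda>t. u0) (\<lambda>_ v t. u0 + integral {0..t} (\<lambda>s. F (v s)))"
  have u_0: "u 0 t = u0" and u_Suc: "u (Suc n) t = u0 + integral {0..t} (\<lambda>s. F (u n s))" for n t
    by (simp_all add: u_def)
  have ucont: "continuous_on {0..T} (u n)" for n
  proof (induction n)
    case (Suc n)
    have "continuous_on {0..T} (\<lambda>s. F (u n s))"
      by (rule continuous_on_compose2[OF Fcont[of UNIV] Suc]) auto
    then have "continuous_on {0..T} (\<lambda>t. integral {0..t} (\<lambda>s. F (u n s)))"
      by (intro indefinite_integral_continuous_1 integrable_continuous_real)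
    then show ?case unfolding u_Suc by (intro continuous_intros)
  qed (simp add: u_0)
  have Fint: "(\<lambda>s. F (u n s)) integrable_on {0..t}" if "t \<le> T" for n t
    using that by (intro integrable_continuous_real continuous_on_compose2[OF Fcont[of UNIV]]
        continuous_on_subset[OF ucont]) auto
  define B where "B = T * norm (F u0)"
  have B: "0 \<le> B" using \<open>0 \<le> T\<close> by (simp add: B_def)
  \<comment> \<open>In the weight \<open>exp (2 * l * t)\<close> the Picard map is a contraction with factor
    1/2, whatever the length \<open>T\<close>.\<close>
  have step: "norm (u (Suc n) t - u n t) \<le> B * (1/2)^n * exp (2 * l * t)" if "t \<in> {0..T}" for n t
    using that
  proof (induction n arbitrary: t)
    case 0
    have "norm (u (Suc 0) t - u 0 t) = t * norm (F u0)"
      using 0 by (simp add: u_Suc u_0)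
    also have "\<dots> \<le> B * 1"
      using 0 by (auto simp: B_def intro!: mult_right_mono)
    also have "\<dots> \<le> B * exp (2 * l * t)"
      using 0 B \<open>0 < l\<close> by (intro mult_left_mono) auto
    finally show ?case by simp
  next
    case (Suc n)
    define c where "c = B * (1/2)^n"
    have c: "0 \<le> c" using B by (simp add: c_def)
    have "((\<lambda>s. l * (c * exp (2 * l * s))) has_integral
            (c / 2 * exp (2 * l * t) - c / 2 * exp (2 * l * 0))) {0..t}"
      using Suc.prems
      by (intro fundamental_theorem_of_calculus)
         (auto intro!: derivative_eq_intros
               simp: has_real_derivative_iff_has_vector_derivative[symmetric])
    note expint = this
    have "u (Suc (Suc n)) t - u (Suc n) t = integral {0..t} (\<lambda>s. F (u (Suc n) s) - F (u n s))"
      using Suc.prems Fint[of t] by (simp add: u_Suc[of "Suc n"] u_Suc[of n t] integral_diff)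
    also have "norm \<dots> \<le> integral {0..t} (\<lambda>s. l * (c * exp (2 * l * s)))"
    proof (rule integral_norm_bound_integral)
      show "(\<lambda>s. F (u (Suc n) s) - F (u n s)) integrable_on {0..t}"
        using Fint Suc.prems by (intro integrable_diff) auto
      show "(\<lambda>s. l * (c * exp (2 * l * s))) integrable_on {0..t}"
        using expint by blast
      fix s assume s: "s \<in> {0..t}"
      have "norm (F (u (Suc n) s) - F (u n s)) \<le> l * norm (u (Suc n) s - u n s)"
        by (rule Flip)
      also have "\<dots> \<le> l * (c * exp (2 * l * s))"
        using Suc.IH[of s] s Suc.prems \<open>0 < l\<close> by (intro mult_left_mono) (auto simp: c_def)
      finally show "norm (F (u (Suc n) s) - F (u n s)) \<le> l * (c * exp (2 * l * s))" .
    qed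
    also have "\<dots> = c / 2 * exp (2 * l * t) - c / 2"
      using integral_unique[OF expint] by simp
    also have "\<dots> \<le> B * (1/2)^(Suc n) * exp (2 * l * t)"
      using c by (simp add: c_def)
    finally show ?case .
  qed
  have "uniform_limit {0..T} (\<lambda>n t. \<Sum>i<n. u (Suc i) t - u i t) (\<lambda>t. \<Sum>i. u (Suc i) t - u i t) sequentially"
  proof (rule Weierstrass_m_test)
    fix n t assume t: "t \<in> {0..T}"
    have "norm (u (Suc n) t - u n t) \<le> B * (1/2)^n * exp (2 * l * t)" by (rule step[OF t])
    also have "\<dots> \<le> B * (1/2)^n * exp (2 * l * T)"
      using t B \<open>0 < l\<close> by (intro mult_left_mono) auto
    finally show "norm (u (Suc n) t - u n t) \<le> B * exp (2 * l * T) * (1/2)^n" by (simp add: ac_simps)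
  next
    show "summable (\<lambda>n. B * exp (2 * l * T) * (1/2)^n)"
      by (intro summable_mult summable_geometric) auto
  qed
  then have "uniform_limit {0..T} (\<lambda>n t. u n t - u0) (\<lambda>t. \<Sum>i. u (Suc i) t - u i t) sequentially"
    using sum_lessThan_telescope[of "\<lambda>n. u n t" for t] by (simp add: u_0)
  then have "uniform_limit {0..T} (\<lambda>n t. u n t - u0 + u0) (\<lambda>t. (\<Sum>i. u (Suc i) t - u i t) + u0) sequentially"
    by (intro uniform_limit_intros)
  then obtain v where v: "uniform_limit {0..T} u v sequentially"
    by simp
  have vcont: "continuous_on {0..T} v"
    by (rule uniform_limit_theorem[OF _ v]) (auto simp: ucont)
  have Fv: "continuous_on {0..T} (\<lambda>s. F (v s))"
    by (rule continuous_on_compose2[OF Fcont[of UNIV] vcont]) auto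
  have Fu: "uniform_limit {0..T} (\<lambda>n s. F (u n s)) (\<lambda>s. F (v s)) sequentially"
    by (rule uniform_limit_compose_uniformly_continuous_on[OF v lipschitz_on_uniformly_continuous[OF lip]])
       (auto simp: closed_UNIV)
  have veq: "v t = u0 + integral {0..t} (\<lambda>s. F (v s))" if t: "t \<in> {0..T}" for t
  proof -
    have "(\<lambda>n. integral {0..t} (\<lambda>s. F (u n s))) \<longlonglongrightarrow> integral {0..t} (\<lambda>s. F (v s))"
    proof -
      have "uniform_limit {0..t} (\<lambda>n s. F (u n s)) (\<lambda>s. F (v s)) sequentially"
        using t by (intro uniform_limit_on_subset[OF Fu]) auto
      then obtain I J where IJ: "\<And>n. ((\<lambda>s. F (u n s)) has_integral I n) {0..t}"
          "((\<lambda>s. F (v s)) has_integral J) {0..t}" "I \<longlonglongrightarrow> J"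
        using t by (elim uniform_limit_integral)
          (auto intro!: continuous_on_compose2[OF Fcont[of UNIV]] continuous_on_subset[OF ucont])
      then show ?thesis
        by (simp add: integral_unique[OF IJ(1)] integral_unique[OF IJ(2)])
    qed
    then have "(\<lambda>n. u (Suc n) t) \<longlonglongrightarrow> u0 + integral {0..t} (\<lambda>s. F (v s))"
      unfolding u_Suc by (intro tendsto_intros)
    moreover have "(\<lambda>n. u (Suc n) t) \<longlonglongrightarrow> v t"
      using tendsto_uniform_limitI[OF v t] by (rule LIMSEQ_Suc)
    ultimately show ?thesis
      using LIMSEQ_unique by blast
  qed
  show ?thesis
  proof
    show "v 0 = u0" using veq[of 0] \<open>0 \<le> T\<close> by simp
    show "ode_on F T v"
      unfolding ode_on_def
    proof
      fix t assume t: "t \<in> {0..T}"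
      have "((\<lambda>t. u0 + integral {0..t} (\<lambda>s. F (v s))) has_vector_derivative F (v t)) (at t within {0..T})"
        using integral_has_vector_derivative[OF Fv t] by (auto intro!: derivative_eq_intros)
      then show "(v has_vector_derivative F (v t)) (at t within {0..T})"
        by (rule has_vector_derivative_transform[OF t _, rotated]) (simp add: veq)
    qed
  qed
qed

lemma ode_unique:
  fixes F :: "'a::real_inner \<Rightarrow> 'a"
  assumes F: "lipschitz_on_balls F" and u: "ode_on F T u" and v: "ode_on F T v" and "u 0 = v 0"
    and t: "t \<in> {0..T}"
  shows "u t = v t"
proof -
  have "compact (u ` {0..T} \<union> v ` {0..T})"
    using ode_on_continuous[OF u] ode_on_continuous[OF v]
    by (intro compact_Un compact_continuous_image) auto
  then obtain R where "\<forall>x \<in> u ` {0..T} \<union> v ` {0..T}. norm x \<le> R"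
    using compact_imp_bounded bounded_iff by metis
  then have R: "norm (u s) \<le> R" "norm (v s) \<le> R" if "s \<in> {0..T}" for s
    using that by auto
  obtain L where L: "0 < L" "\<And>x y. norm x \<le> R \<Longrightarrow> norm y \<le> R \<Longrightarrow> norm (F x - F y) \<le> L * norm (x - y)"
    using lipschitz_on_ballsE[OF F, of R] by blast
  have "(norm (u t - v t))\<^sup>2 \<le> exp (2 * L * t) * ((norm (u 0 - v 0))\<^sup>2 + 0)"
  proof (rule gronwall_differential[where p = "\<lambda>_. 2 * L" and q = "\<lambda>_. 0"
        and \<Phi>' = "\<lambda>s. 2 * ((u s - v s) \<bullet> (F (u s) - F (v s)))"])
    fix s assume s: "s \<in> {0..t}"
    show "((\<lambda>s. (norm (u s - v s))\<^sup>2) has_real_derivative 2 * ((u s - v s) \<bullet> (F (u s) - F (v s)))) (at s within {0..t})"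
      using t s by (intro has_vector_derivative_norm_sq derivative_intros
        has_vector_derivative_within_subset[OF ode_onD[OF u]] has_vector_derivative_within_subset[OF ode_onD[OF v]]) auto
    have "(u s - v s) \<bullet> (F (u s) - F (v s)) \<le> norm (u s - v s) * norm (F (u s) - F (v s))"
      by (rule norm_cauchy_schwarz)
    also have "\<dots> \<le> norm (u s - v s) * (L * norm (u s - v s))"
      using s t R by (intro mult_left_mono L) auto
    finally show "2 * ((u s - v s) \<bullet> (F (u s) - F (v s))) \<le> 2 * L * (norm (u s - v s))\<^sup>2 + 0"
      by (simp add: power2_eq_square ac_simps)
  qed (use t L in \<open>auto intro!: derivative_eq_intros\<close>)
  then show ?thesis using \<open>u 0 = v 0\<close> by simp
qed

text \<open>
  Continuation in the form of an a priori estimate: a solution that is known to lie in the closed tube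
  \<open>G \<le> 0\<close> up to some time can be shown to lie in the open tube at that time. Then no solution leaves the tube.
  For the proof the field is composed with the projection onto a ball containing the tube, which makes it globally
  Lipschitz; the solution of the modified equation stays in the tube and therefore solves the original one.
\<close>

lemma ode_exists_in_tube:
  fixes F :: "'a::euclidean_space \<Rightarrow> 'a" and G :: "real \<Rightarrow> 'a \<Rightarrow> real"
  assumes F: "lipschitz_on_balls F" and "0 \<le> T"
    and Gcont: "continuous_on ({0..T} \<times> UNIV) (\<lambda>(s, x). G s x)"
    and Gbdd: "\<And>s x. s \<in> {0..T} \<Longrightarrow> G s x \<le> 0 \<Longrightarrow> norm x \<le> R"
    and init: "G 0 u0 \<le> 0"
    and improve: "\<And>s u. s \<in> {0..T} \<Longrightarrow> u 0 = u0 \<Longrightarrow> ode_on F s u \<Longrightarrow>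
      (\<And>r. r \<in> {0..s} \<Longrightarrow> G r (u r) \<le> 0) \<Longrightarrow> G s (u s) < 0"
  obtains u where "u 0 = u0" "ode_on F T u" "\<And>s. s \<in> {0..T} \<Longrightarrow> G s (u s) \<le> 0"
proof -
  define pr where "pr = closest_point (cball (0::'a) R)"
  have "norm u0 \<le> R" using Gbdd[OF _ init] \<open>0 \<le> T\<close> by simp
  then have "0 \<le> R" using norm_ge_zero[of u0] by linarith
  then have ne: "cball (0::'a) R \<noteq> {}" by simp
  have pr_lip: "1-lipschitz_on UNIV pr"
    unfolding pr_def using closest_point_lipschitz[OF convex_cball closed_cball ne]
    by (intro lipschitz_onI) auto
  have pr_in: "pr x \<in> cball 0 R" for x
    unfolding pr_def using ne by (intro closest_point_in_set) auto
  have pr_self: "pr x = x" if "norm x \<le> R" for x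
    unfolding pr_def using that by (intro closest_point_self) auto
  obtain L where "L-lipschitz_on (cball 0 R) F" using F unfolding lipschitz_on_balls_def by blast
  then have "L-lipschitz_on (pr ` UNIV) F"
    by (rule lipschitz_on_subset) (use pr_in in blast)
  then have "(L * 1)-lipschitz_on UNIV (\<lambda>x. F (pr x))"
    by (rule lipschitz_on_compose2[OF pr_lip])
  \<comment> \<open>\<open>v\<close> solves the original equation as long as it stays in the ball of radius
    \<open>R\<close>.\<close>
  then obtain v where v: "v 0 = u0" "ode_on (\<lambda>x. F (pr x)) T v"
    using \<open>0 \<le> T\<close> by (rule picard_lindelof_global)
  have vF: "ode_on F s v" if s: "s \<le> T" "\<And>r. r \<in> {0..s} \<Longrightarrow> G r (v r) \<le> 0" for s
    unfolding ode_on_def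
  proof
    fix r assume r: "r \<in> {0..s}"
    have "norm (v r) \<le> R" using Gbdd[OF _ s(2)[OF r]] s(1) r by auto
    then show "(v has_vector_derivative F (v r)) (at r within {0..s})"
      using ode_onD[OF ode_on_subset[OF v(2) s(1)] r] by (simp add: pr_self)
  qed
  define g where "g s = G s (v s)" for s
  have gcont: "continuous_on {0..T} g"
  proof -
    have "continuous_on {0..T} (\<lambda>s. (\<lambda>(s, x). G s x) (s, v s))"
      using ode_on_continuous[OF v(2)]
      by (intro continuous_on_compose2[OF Gcont] continuous_intros) auto
    then show ?thesis by (simp add: g_def)
  qed
  have "g s < 0" if s0: "s \<in> {0..T}" for s
  proof (rule ccontr)
    \<comment> \<open>If the claim fails, the first time \<open>m\<close> with \<open>0 \<le> g m\<close>
      contradicts \<open>improve\<close>.\<close>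
    define Z where "Z = {0..T} \<inter> g -` {0..}"
    assume "\<not> g s < 0"
    then have "s \<in> Z" using s0 by (simp add: Z_def)
    have "compact Z"
      unfolding Z_def compact_eq_bounded_closed
      by (auto intro!: continuous_closed_preimage gcont bounded_Int)
    then obtain m where m: "m \<in> Z" "\<And>r. r \<in> Z \<Longrightarrow> m \<le> r"
      using \<open>s \<in> Z\<close> compact_attains_inf[of Z] by blast
    have mT: "m \<in> {0..T}" and "0 \<le> g m" using m(1) by (auto simp: Z_def)
    have before: "g r < 0" if "r \<in> {0..<m}" for r
      using m(2)[of r] that mT by (force simp: Z_def)
    have "g m \<le> 0"
    proof (cases "m = 0")
      case True
      then show ?thesis using init v(1) by (simp add: g_def)
    next
      case False
      then have "0 < m" using mT by auto
      have "(g \<longlongrightarrow> g m) (at m within {0..m})"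
        using continuous_on_subset[OF gcont, of "{0..m}"] mT by (simp add: continuous_on_def)
      then have "(g \<longlongrightarrow> g m) (at_left m)"
        using at_within_Icc_at_left[OF \<open>0 < m\<close>] by simp
      moreover have "eventually (\<lambda>r. g r \<le> 0) (at_left m)"
        using eventually_at_left_real[OF \<open>0 < m\<close>]
        by eventually_elim (use before in \<open>force intro: less_imp_le\<close>)
      ultimately show ?thesis
        by (rule tendsto_upperbound) auto
    qed
    then have upto: "G r (v r) \<le> 0" if "r \<in> {0..m}" for r
      using before[of r] that by (cases "r = m") (auto simp: g_def intro: less_imp_le)
    then have "g m < 0"
      unfolding g_def using mT vF[of m] by (intro improve v(1)) auto
    then show False using \<open>0 \<le> g m\<close> by simp
  qed
  then have le: "G s (v s) \<le> 0" if "s \<in> {0..T}" for s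
    using that by (auto simp: g_def intro: less_imp_le)
  with vF[of T] have "ode_on F T v" by auto
  with v(1) le show ?thesis using that by blast
qed

lemma ode_global:
  fixes F :: "'a::real_inner \<Rightarrow> 'a"
  assumes F: "lipschitz_on_balls F" and ex: "\<And>T. 0 \<le> T \<Longrightarrow> \<exists>u. u 0 = u0 \<and> ode_on F T u"
  obtains u where "u 0 = u0" "\<And>T. ode_on F T u"
proof -
  \<comment> \<open>By uniqueness the solutions on different intervals agree, so the diagonal \<open>U s
    s\<close> extends all of them.\<close>
  define U where "U T = (SOME u. u 0 = u0 \<and> ode_on F T u)" for T
  have U: "U T 0 = u0" "ode_on F T (U T)" if "0 \<le> T" for T
    using someI_ex[OF ex[OF that]] by (simp_all add: U_def)
  define u where "u s = U s s" for s
  have eq: "u s = U T s" if "s \<in> {0..T}" for s T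
  proof -
    have "U s s = U T s"
      using that U(1)[of s] U(1)[of T] ode_on_subset[OF U(2), of T s]
      by (intro ode_unique[OF F U(2), of s "U T" s]) auto
    then show ?thesis by (simp add: u_def)
  qed
  have "ode_on F T u" for T
    unfolding ode_on_def
  proof
    fix s assume s: "s \<in> {0..T}"
    then have "(U T has_vector_derivative F (u s)) (at s within {0..T})"
      using ode_onD[OF U(2) s] eq[OF s] by simp
    then show "(u has_vector_derivative F (u s)) (at s within {0..T})"
      by (rule has_vector_derivative_transform[OF s, rotated]) (simp add: eq)
  qed
  moreover have "u 0 = u0" using U[of 0] by (simp add: u_def)
  ultimately show ?thesis using that by blast
qed

section \<open>Energy estimates with an initial layer\<close>

text \<open>
  A damped equation whose damping is disturbed, and whose forcing is driven, by terms that decay exponentially.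
  The total disturbance \<open>C / w\<close> costs only a constant factor.
\<close>

lemma exponential_decay:
  fixes Y Y' :: "real \<Rightarrow> 'a::real_inner"
  assumes pos: "0 \<le> t" "0 < a" "0 < w" "0 \<le> C" "0 \<le> c"
    and Y: "\<And>s. s \<in> {0..t} \<Longrightarrow> (Y has_vector_derivative Y' s) (at s within {0..t})"
    and le: "\<And>s. s \<in> {0..t} \<Longrightarrow>
      Y s \<bullet> Y' s \<le> (- a + C * exp (- w * s)) * (norm (Y s))\<^sup>2 + c * exp (- w * s) * norm (Y s)"
  shows "norm (Y t) \<le> sqrt (exp (2 * C / w) * ((norm (Y 0))\<^sup>2 + c\<^sup>2 / (a * w))) * exp (- (min a w / 2) * t)"
proof -
  \<comment> \<open>The energy is damped at the rate \<open>2 * a\<close>, half of which is spent on absorbing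
    the forcing.\<close>
  define m where "m = min a w"
  define P where "P s = 2 * C / w * (1 - exp (- w * s))" for s
  define Q where "Q s = c\<^sup>2 / (a * w) * (1 - exp (- w * s))" for s
  define \<Phi>' where "\<Phi>' s = 2 * (Y s \<bullet> Y' s) * exp (m * s) + (norm (Y s))\<^sup>2 * (m * exp (m * s))" for s
  have "(norm (Y t))\<^sup>2 * exp (m * t) \<le> exp (P t) * ((norm (Y 0))\<^sup>2 * exp (m * 0) + Q t)"
  proof (rule gronwall_differential[where p = "\<lambda>s. 2 * C * exp (- w * s)" and q = "\<lambda>s. c\<^sup>2 / a * exp (- w * s)" and \<Phi>' = \<Phi>'])
    fix s assume s: "s \<in> {0..t}"
    show "((\<lambda>s. (norm (Y s))\<^sup>2 * exp (m * s)) has_real_derivative \<Phi>' s) (at s within {0..t})"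
    proof -
      have "((\<lambda>s. exp (m * s)) has_real_derivative m * exp (m * s)) (at s within {0..t})"
        by (auto intro!: derivative_eq_intros)
      from DERIV_mult[OF has_vector_derivative_norm_sq[OF Y[OF s]] this]
      show ?thesis by (simp add: \<Phi>'_def ac_simps)
    qed
    show "(P has_real_derivative 2 * C * exp (- w * s)) (at s within {0..t})"
      unfolding P_def using \<open>0 < w\<close> by (auto intro!: derivative_eq_intros)
    show "(Q has_real_derivative c\<^sup>2 / a * exp (- w * s)) (at s within {0..t})"
      unfolding Q_def using \<open>0 < w\<close> \<open>0 < a\<close> by (auto intro!: derivative_eq_intros simp: field_simps)
    show "0 \<le> P s" using pos s by (simp add: P_def)
    show "0 \<le> c\<^sup>2 / a * exp (- w * s)" using pos by simp
    define x where "x = exp (- w * s)"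
    define y where "y = exp (m * s)"
    define n where "n = norm (Y s)"
    have xy: "0 < x" "0 < y" by (simp_all add: x_def y_def)
    have "y * x \<le> 1"
    proof -
      have "m * s \<le> w * s" using s pos by (intro mult_right_mono) (auto simp: m_def)
      then show ?thesis by (simp add: x_def y_def flip: exp_add)
    qed
    have "2 * (c * x) * n \<le> a * n\<^sup>2 + (c * x)\<^sup>2 / a"
      using sum_squares_bound[of "a * n" "c * x"] \<open>0 < a\<close> by (simp add: field_simps power2_eq_square)
    moreover have "m * n\<^sup>2 \<le> a * n\<^sup>2" by (intro mult_right_mono) (auto simp: m_def)
    moreover have "2 * (Y s \<bullet> Y' s) \<le> - 2 * a * n\<^sup>2 + 2 * C * x * n\<^sup>2 + 2 * (c * x) * n"
      using le[OF s] by (simp add: x_def n_def algebra_simps)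
    ultimately have "2 * (Y s \<bullet> Y' s) + m * n\<^sup>2 \<le> 2 * C * x * n\<^sup>2 + (c * x)\<^sup>2 / a"
      by linarith
    then have "(2 * (Y s \<bullet> Y' s) + m * n\<^sup>2) * y \<le> (2 * C * x * n\<^sup>2 + (c * x)\<^sup>2 / a) * y"
      using xy by (intro mult_right_mono) auto
    also have "\<dots> = 2 * C * x * (n\<^sup>2 * y) + c\<^sup>2 / a * x * (y * x)"
      by (simp add: algebra_simps power2_eq_square)
    also have "\<dots> \<le> 2 * C * x * (n\<^sup>2 * y) + c\<^sup>2 / a * x * 1"
      using \<open>y * x \<le> 1\<close> xy \<open>0 < a\<close> by (intro add_left_mono mult_left_mono) auto
    finally show "\<Phi>' s \<le> 2 * C * exp (- w * s) * ((norm (Y s))\<^sup>2 * exp (m * s)) + c\<^sup>2 / a * exp (- w * s)"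
      by (simp add: \<Phi>'_def x_def y_def n_def algebra_simps)
  qed (use pos in \<open>auto simp: P_def Q_def\<close>)
  also have "\<dots> \<le> exp (2 * C / w) * ((norm (Y 0))\<^sup>2 + c\<^sup>2 / (a * w))"
  proof (intro mult_mono add_mono)
    have "2 * C / w * (1 - exp (- w * t)) \<le> 2 * C / w * 1"
      using pos by (intro mult_left_mono) auto
    then show "exp (P t) \<le> exp (2 * C / w)" by (simp add: P_def)
    have "c\<^sup>2 / (a * w) * (1 - exp (- w * t)) \<le> c\<^sup>2 / (a * w) * 1"
      using pos by (intro mult_left_mono) auto
    then show "Q t \<le> c\<^sup>2 / (a * w)" by (simp add: Q_def)
    show "0 \<le> (norm (Y 0))\<^sup>2 * exp (m * 0) + Q t"
      using pos by (auto simp: Q_def intro!: add_nonneg_nonneg)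
  qed auto
  finally have "sqrt ((norm (Y t))\<^sup>2 * exp (m * t)) \<le> sqrt (exp (2 * C / w) * ((norm (Y 0))\<^sup>2 + c\<^sup>2 / (a * w)))"
    by (rule real_sqrt_le_mono)
  moreover have "sqrt ((norm (Y t))\<^sup>2 * exp (m * t)) = norm (Y t) * exp (m / 2 * t)"
  proof -
    have "exp (m * t) = (exp (m / 2 * t))\<^sup>2" by (simp flip: exp_double)
    then show ?thesis by (simp add: real_sqrt_mult)
  qed
  ultimately have "norm (Y t) * exp (m / 2 * t) * exp (- (m / 2) * t)
      \<le> sqrt (exp (2 * C / w) * ((norm (Y 0))\<^sup>2 + c\<^sup>2 / (a * w))) * exp (- (m / 2) * t)"
    by (intro mult_right_mono) auto
  then show ?thesis by (simp add: m_def mult.assoc flip: exp_add)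
qed

text \<open>
  A fast variable with damping \<open>a / e\<close>, except in an initial layer of width \<open>O(e)\<close> where the sign of the
  damping is not controlled. The layer multiplies the energy by at most \<open>exp (2 * C / m)\<close>, after which the forcing
  \<open>b\<close> is balanced by the damping \<open>a\<close>.
\<close>

lemma layer_energy:
  fixes E E' :: "real \<Rightarrow> 'a::real_inner"
  assumes pos: "0 \<le> t" "0 < e" "0 < a" "0 \<le> b" "0 \<le> C" "0 < m"
    and E: "\<And>s. s \<in> {0..t} \<Longrightarrow> (E has_vector_derivative E' s) (at s within {0..t})"
    and "E 0 = 0"
    and le: "\<And>s. s \<in> {0..t} \<Longrightarrow>
      e * (E s \<bullet> E' s) \<le> (- a + C * exp (- m * s / e)) * (norm (E s))\<^sup>2 + b * norm (E s)"
  shows "norm (E t) \<le> exp (C / m) * b / a"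
proof -
  \<comment> \<open>\<open>P\<close> is the integral of the transient growth rate; it is at most \<open>2 * C /
    m\<close>, uniformly in \<open>e\<close>.\<close>
  define P where "P s = 2 * C / m * (1 - exp (- m * s / e))" for s
  define Q where "Q s = (b / a)\<^sup>2 * (exp (a * s / e) - 1)" for s
  define \<Phi>' where "\<Phi>' s = 2 * (E s \<bullet> E' s) * exp (a * s / e) + (norm (E s))\<^sup>2 * (a / e * exp (a * s / e))" for s
  have "(norm (E t))\<^sup>2 * exp (a * t / e) \<le> exp (P t) * ((norm (E 0))\<^sup>2 * exp (a * 0 / e) + Q t)"
  proof (rule gronwall_differential[where p = "\<lambda>s. 2 * C / e * exp (- m * s / e)"
        and q = "\<lambda>s. b\<^sup>2 / (a * e) * exp (a * s / e)" and \<Phi>' = \<Phi>'])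
    fix s assume s: "s \<in> {0..t}"
    show "((\<lambda>s. (norm (E s))\<^sup>2 * exp (a * s / e)) has_real_derivative \<Phi>' s) (at s within {0..t})"
    proof -
      have "((\<lambda>s. exp (a * s / e)) has_real_derivative a / e * exp (a * s / e)) (at s within {0..t})"
        using \<open>0 < e\<close> by (auto intro!: derivative_eq_intros simp: field_simps)
      from DERIV_mult[OF has_vector_derivative_norm_sq[OF E[OF s]] this]
      show ?thesis by (simp add: \<Phi>'_def ac_simps)
    qed
    show "(P has_real_derivative 2 * C / e * exp (- m * s / e)) (at s within {0..t})"
      unfolding P_def using \<open>0 < e\<close> \<open>0 < m\<close>
      by (auto intro!: derivative_eq_intros simp: field_simps)
    show "(Q has_real_derivative b\<^sup>2 / (a * e) * exp (a * s / e)) (at s within {0..t})"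
      unfolding Q_def using \<open>0 < e\<close> \<open>0 < a\<close>
      by (auto intro!: derivative_eq_intros simp: field_simps power2_eq_square)
    show "0 \<le> P s"
      using pos s by (auto simp: P_def)
    show "0 \<le> b\<^sup>2 / (a * e) * exp (a * s / e)"
      using pos by auto
    define x where "x = exp (- m * s / e)"
    define y where "y = exp (a * s / e)"
    define n where "n = norm (E s)"
    have "0 < y" by (simp add: y_def)
    have "2 * b * n \<le> a * n\<^sup>2 + b\<^sup>2 / a"
      using sum_squares_bound[of "a * n" b] \<open>0 < a\<close> by (simp add: field_simps power2_eq_square)
    then have "2 * (e * (E s \<bullet> E' s)) + a * n\<^sup>2 \<le> 2 * C * x * n\<^sup>2 + b\<^sup>2 / a"
      using le[OF s] by (simp add: x_def n_def algebra_simps)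
    then have "(2 * (e * (E s \<bullet> E' s)) + a * n\<^sup>2) * (y / e) \<le> (2 * C * x * n\<^sup>2 + b\<^sup>2 / a) * (y / e)"
      using \<open>0 < y\<close> \<open>0 < e\<close> by (intro mult_right_mono) auto
    then show "\<Phi>' s \<le> 2 * C / e * exp (- m * s / e) * ((norm (E s))\<^sup>2 * exp (a * s / e))
        + b\<^sup>2 / (a * e) * exp (a * s / e)"
      unfolding \<Phi>'_def x_def[symmetric] y_def[symmetric] n_def[symmetric]
      using \<open>0 < e\<close> by (simp add: field_simps)
  qed (use pos \<open>E 0 = 0\<close> in \<open>auto simp: P_def Q_def\<close>)
  also have "\<dots> = exp (P t) * Q t"
    using \<open>E 0 = 0\<close> by simp
  also have "\<dots> \<le> exp (2 * C / m) * ((b / a)\<^sup>2 * exp (a * t / e))"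
  proof (intro mult_mono)
    have "2 * C / m * (1 - exp (- m * t / e)) \<le> 2 * C / m * 1"
      using pos by (intro mult_left_mono) auto
    then show "exp (P t) \<le> exp (2 * C / m)" by (simp add: P_def)
    show "Q t \<le> (b / a)\<^sup>2 * exp (a * t / e)" by (simp add: Q_def right_diff_distrib)
    show "0 \<le> Q t" using pos by (simp add: Q_def)
  qed auto
  finally have "(norm (E t))\<^sup>2 \<le> exp (2 * C / m) * (b / a)\<^sup>2"
    by (simp flip: mult.assoc)
  also have "\<dots> = (exp (C / m) * b / a)\<^sup>2"
    by (simp add: power_mult_distrib power_divide flip: exp_double) 
  finally show ?thesis
    by (rule power2_le_imp_le) (use pos in simp)
qed

text \<open>
  A slow variable \<open>X\<close> coupled to a fast variable \<open>Y\<close> that starts from zero error: \<open>X\<close> is forced by \<open>Y\<close> and by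
  an initial layer, and \<open>Y\<close> is forced by \<open>X\<close> and by terms of order \<open>e\<close>. The energy
  \<open>(norm X)\<^sup>2 + e * (norm Y)\<^sup>2\<close> gives the order of \<open>X\<close>, and with this knowledge \<open>layer_energy\<close> gives that of \<open>Y\<close>.
  The bounds are uniform because the constants do not involve \<open>e\<close>.
\<close>

lemma slow_fast_energy:
  fixes X X' :: "real \<Rightarrow> 'a::real_inner" and Y Y' :: "real \<Rightarrow> 'b::real_inner"
  fixes a b C L T e k m :: real
  defines "M \<equiv> exp ((2 * L + 2 * L\<^sup>2 / a + 2 * b\<^sup>2 / a) * T + (2 * C + 1) / m)
                * (L\<^sup>2 * k\<^sup>2 / m + 2 * b\<^sup>2 / a * T)"
  assumes pos: "0 \<le> t" "t \<le> T" "0 < e" "0 < a" "0 \<le> b" "0 \<le> C" "0 < m" "0 \<le> L" "0 \<le> k"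
    and X: "\<And>s. s \<in> {0..t} \<Longrightarrow> (X has_vector_derivative X' s) (at s within {0..t})" and "X 0 = 0"
    and Y: "\<And>s. s \<in> {0..t} \<Longrightarrow> (Y has_vector_derivative Y' s) (at s within {0..t})" and "Y 0 = 0"
    and X_le: "\<And>s. s \<in> {0..t} \<Longrightarrow>
      X s \<bullet> X' s \<le> L * norm (X s) * (norm (X s) + norm (Y s) + k * exp (- m * s / e))"
    and Y_le: "\<And>s. s \<in> {0..t} \<Longrightarrow>
      e * (Y s \<bullet> Y' s) \<le> (- a + C * exp (- m * s / e)) * (norm (Y s))\<^sup>2 + b * norm (Y s) * (e + norm (X s))"
  shows "norm (X t) \<le> sqrt M * e" "norm (Y t) \<le> exp (C / m) * b * (1 + sqrt M) / a * e"
proof -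
  define c where "c = 2 * L + 2 * L\<^sup>2 / a + 2 * b\<^sup>2 / a"
  have c: "0 \<le> c" using pos by (simp add: c_def)
  have "0 \<le> T" using pos by simp
  have M: "0 \<le> M" using pos \<open>0 \<le> T\<close> by (simp add: M_def)
  have X_bound: "norm (X r) \<le> sqrt M * e" if r: "r \<in> {0..t}" for r
  proof -
    define P where "P s = c * s + (2 * C + 1) / m * (1 - exp (- m * s / e))" for s
    define p where "p s = c + (2 * C + 1) / e * exp (- m * s / e)" for s
    define Q where "Q s = L\<^sup>2 * k\<^sup>2 * e\<^sup>2 / m * (1 - exp (- m * s / e)) + 2 * b\<^sup>2 / a * e\<^sup>2 * s" for s
    define q where "q s = L\<^sup>2 * k\<^sup>2 * e * exp (- m * s / e) + 2 * b\<^sup>2 / a * e\<^sup>2" for s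
    \<comment> \<open>The weight \<open>e\<close> makes the damping of \<open>Y\<close> in \<open>\<Phi>\<close>
      of order one, enough to absorb the coupling of \<open>X\<close> to \<open>Y\<close>.\<close>
    define \<Phi> where "\<Phi> s = (norm (X s))\<^sup>2 + e * (norm (Y s))\<^sup>2" for s
    have "\<Phi> r \<le> exp (P r) * (\<Phi> 0 + Q r)"
    proof (rule gronwall_differential[where p = p and q = q and \<Phi>' = "\<lambda>s. 2 * (X s \<bullet> X' s) + e * (2 * (Y s \<bullet> Y' s))"])
      fix s assume "s \<in> {0..r}"
      then have s: "s \<in> {0..t}" "{0..r} \<subseteq> {0..t}" using r by auto
      show "(\<Phi> has_real_derivative 2 * (X s \<bullet> X' s) + e * (2 * (Y s \<bullet> Y' s))) (at s within {0..r})"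
        unfolding \<Phi>_def
        by (intro DERIV_add DERIV_cmult has_vector_derivative_norm_sq
            has_vector_derivative_within_subset[OF X[OF s(1)] s(2)]
            has_vector_derivative_within_subset[OF Y[OF s(1)] s(2)])
      show "(P has_real_derivative p s) (at s within {0..r})"
        unfolding P_def p_def using \<open>0 < e\<close> \<open>0 < m\<close>
        by (auto intro!: derivative_eq_intros simp: field_simps)
      show "(Q has_real_derivative q s) (at s within {0..r})"
        unfolding Q_def q_def using \<open>0 < e\<close> \<open>0 < m\<close> \<open>0 < a\<close>
        by (auto intro!: derivative_eq_intros simp: field_simps power2_eq_square)
      show "0 \<le> P s" using pos s c by (auto simp: P_def intro!: add_nonneg_nonneg)
      show "0 \<le> q s" using pos by (auto simp: q_def)
      define x where "x = exp (- m * s / e)"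
      define n where "n = norm (X s)"
      define v where "v = norm (Y s)"
      have x: "0 < x" "x \<le> 1" and nv: "0 \<le> n" "0 \<le> v" using s \<open>0 < m\<close> \<open>0 < e\<close> by (auto simp: x_def n_def v_def)
      have 1: "X s \<bullet> X' s \<le> L * n * (n + v + k * x)"
        using X_le[OF s(1)] by (simp add: x_def n_def v_def)
      have 2: "e * (Y s \<bullet> Y' s) \<le> (- a + C * x) * v\<^sup>2 + b * v * (e + n)"
        using Y_le[OF s(1)] by (simp add: x_def n_def v_def)
      have young: "2 * u * w \<le> d * u\<^sup>2 + w\<^sup>2 / d" if "0 < d" for u w d :: real
        using sum_squares_bound[of "d * u" w] that by (simp add: field_simps power2_eq_square)
      have 3: "2 * L * n * v \<le> a / 2 * v\<^sup>2 + 2 * L\<^sup>2 / a * n\<^sup>2"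
        using young[of "a / 2" v "L * n"] \<open>0 < a\<close> by (simp add: power_mult_distrib ac_simps)
      \<comment> \<open>The forcing \<open>k * x\<close> is of order one in the layer, but its integral is of
        order \<open>e\<close>; splitting with the weight \<open>x / e\<close> gives a growth rate with bounded
        integral and a source of integral \<open>O(e\<^sup>2)\<close>.\<close>
      have "2 * (L * k * e) * n \<le> e\<^sup>2 * (L\<^sup>2 * k\<^sup>2) + n\<^sup>2"
        using young[of 1 "L * k * e" n] by (simp add: power_mult_distrib ac_simps)
      then have "2 * (L * k * e) * n * (x / e) \<le> (e\<^sup>2 * (L\<^sup>2 * k\<^sup>2) + n\<^sup>2) * (x / e)"
        using x \<open>0 < e\<close> by (intro mult_right_mono) auto
      then have 4: "2 * L * n * (k * x) \<le> L\<^sup>2 * k\<^sup>2 * e * x + 1 / e * x * n\<^sup>2"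
        using \<open>0 < e\<close> by (simp add: field_simps power2_eq_square)
      have "2 * (b * v * (e + n)) \<le> a * v\<^sup>2 + (b * (e + n))\<^sup>2 / a"
        using young[OF \<open>0 < a\<close>, of v "b * (e + n)"] by (simp only: ac_simps)
      moreover have "(b * (e + n))\<^sup>2 / a \<le> 2 * b\<^sup>2 / a * (e\<^sup>2 + n\<^sup>2)"
      proof -
        have "(e + n)\<^sup>2 \<le> 2 * (e\<^sup>2 + n\<^sup>2)"
          using sum_squares_bound[of e n] by (simp add: power2_sum)
        then have "b\<^sup>2 / a * (e + n)\<^sup>2 \<le> b\<^sup>2 / a * (2 * (e\<^sup>2 + n\<^sup>2))"
          using \<open>0 < a\<close> by (intro mult_left_mono) auto
        moreover have "(b * (e + n))\<^sup>2 / a = b\<^sup>2 / a * (e + n)\<^sup>2"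
          by (simp add: power_mult_distrib)
        moreover have "b\<^sup>2 / a * (2 * (e\<^sup>2 + n\<^sup>2)) = 2 * b\<^sup>2 / a * (e\<^sup>2 + n\<^sup>2)"
          by simp
        ultimately show ?thesis by (simp only:)
      qed
      ultimately have 5: "2 * (b * v * (e + n)) \<le> a * v\<^sup>2 + 2 * b\<^sup>2 / a * (e\<^sup>2 + n\<^sup>2)"
        by linarith
      have 6: "1 / e * x * n\<^sup>2 + 2 * C * x * v\<^sup>2 \<le> (2 * C + 1) / e * x * (n\<^sup>2 + e * v\<^sup>2)"
      proof -
        define y where "y = x / e"
        have y: "0 \<le> y" "x = y * e" using x \<open>0 < e\<close> by (auto simp: y_def)
        have "0 \<le> 2 * C * y * n\<^sup>2 + x * v\<^sup>2" using \<open>0 \<le> C\<close> x y by simp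
        then have "y * n\<^sup>2 + 2 * C * x * v\<^sup>2 \<le> (2 * C + 1) * y * (n\<^sup>2 + e * v\<^sup>2)"
          by (simp add: y(2) algebra_simps)
        then show ?thesis by (simp add: y_def)
      qed
      have 7: "c * n\<^sup>2 \<le> c * (n\<^sup>2 + e * v\<^sup>2)"
        using c \<open>0 < e\<close> by (intro mult_left_mono) auto
      have "2 * (X s \<bullet> X' s) + 2 * (e * (Y s \<bullet> Y' s))
          \<le> 2 * L * n\<^sup>2 + (a / 2 * v\<^sup>2 + 2 * L\<^sup>2 / a * n\<^sup>2) + (L\<^sup>2 * k\<^sup>2 * e * x + 1 / e * x * n\<^sup>2)
            + 2 * ((- a + C * x) * v\<^sup>2) + (a * v\<^sup>2 + 2 * b\<^sup>2 / a * (e\<^sup>2 + n\<^sup>2))"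
      proof -
        have "2 * (X s \<bullet> X' s) \<le> 2 * L * n\<^sup>2 + 2 * L * n * v + 2 * L * n * (k * x)"
          using 1 by (simp add: algebra_simps power2_eq_square)
        then show ?thesis using 2 3 4 5 by linarith
      qed
      also have "\<dots> = c * n\<^sup>2 + (1 / e * x * n\<^sup>2 + 2 * C * x * v\<^sup>2) - a / 2 * v\<^sup>2
          + (L\<^sup>2 * k\<^sup>2 * e * x + 2 * b\<^sup>2 / a * e\<^sup>2)"
        by (simp add: c_def algebra_simps add_divide_distrib)
      also have "\<dots> \<le> c * (n\<^sup>2 + e * v\<^sup>2) + (2 * C + 1) / e * x * (n\<^sup>2 + e * v\<^sup>2) - 0
          + (L\<^sup>2 * k\<^sup>2 * e * x + 2 * b\<^sup>2 / a * e\<^sup>2)"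
        using 6 7 \<open>0 < a\<close> by (intro add_right_mono diff_mono) (auto simp: add_mono)
      also have "\<dots> = p s * \<Phi> s + q s"
        by (simp add: p_def q_def \<Phi>_def x_def n_def v_def distrib_right)
      finally show "2 * (X s \<bullet> X' s) + e * (2 * (Y s \<bullet> Y' s)) \<le> p s * \<Phi> s + q s"
        by (simp only: mult.left_commute[of e])
    qed (use r in \<open>auto simp: P_def Q_def\<close>)
    also have "\<Phi> 0 = 0" using \<open>X 0 = 0\<close> \<open>Y 0 = 0\<close> by (simp add: \<Phi>_def)
    also have "exp (P r) * (0 + Q r) \<le> exp (c * T + (2 * C + 1) / m) * ((L\<^sup>2 * k\<^sup>2 / m + 2 * b\<^sup>2 / a * T) * e\<^sup>2)"
    proof (intro mult_mono)
      have "(2 * C + 1) / m * (1 - exp (- m * r / e)) \<le> (2 * C + 1) / m * 1"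
        using pos by (intro mult_left_mono) auto
      moreover have "c * r \<le> c * T" using r c \<open>t \<le> T\<close> by (intro mult_left_mono) auto
      ultimately show "exp (P r) \<le> exp (c * T + (2 * C + 1) / m)" by (simp add: P_def)
      have "L\<^sup>2 * k\<^sup>2 * e\<^sup>2 / m * (1 - exp (- m * r / e)) \<le> L\<^sup>2 * k\<^sup>2 * e\<^sup>2 / m * 1"
        using pos by (intro mult_left_mono) auto
      moreover have "2 * b\<^sup>2 / a * e\<^sup>2 * r \<le> 2 * b\<^sup>2 / a * e\<^sup>2 * T"
        using \<open>0 < a\<close> \<open>t \<le> T\<close> r by (intro mult_left_mono) auto
      ultimately show "0 + Q r \<le> (L\<^sup>2 * k\<^sup>2 / m + 2 * b\<^sup>2 / a * T) * e\<^sup>2"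
        by (simp add: Q_def distrib_right mult.commute[of T] mult.assoc)
      show "0 \<le> 0 + Q r"
        using pos r by (auto simp: Q_def intro!: add_nonneg_nonneg mult_nonneg_nonneg)
    qed auto
    also have "\<dots> = (sqrt M * e)\<^sup>2"
      using M by (simp add: M_def c_def power_mult_distrib)
    finally have "(norm (X r))\<^sup>2 + e * (norm (Y r))\<^sup>2 \<le> (sqrt M * e)\<^sup>2"
      by (simp add: \<Phi>_def)
    moreover have "0 \<le> e * (norm (Y r))\<^sup>2" using \<open>0 < e\<close> by simp
    ultimately have "(norm (X r))\<^sup>2 \<le> (sqrt M * e)\<^sup>2" by linarith
    then show ?thesis
      by (rule power2_le_imp_le) (use real_sqrt_ge_zero[OF M] \<open>0 < e\<close> in simp)
  qed
  then show "norm (X t) \<le> sqrt M * e" using \<open>0 \<le> t\<close> by simp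
  have "norm (Y t) \<le> exp (C / m) * (b * (1 + sqrt M) * e) / a"
  proof (rule layer_energy[where E' = Y' and e = e])
    fix s assume s: "s \<in> {0..t}"
    have "b * norm (Y s) * (e + norm (X s)) \<le> b * norm (Y s) * (e + sqrt M * e)"
      using X_bound[OF s] \<open>0 \<le> b\<close> by (intro mult_left_mono) auto
    then show "e * (Y s \<bullet> Y' s) \<le> (- a + C * exp (- m * s / e)) * (norm (Y s))\<^sup>2 + b * (1 + sqrt M) * e * norm (Y s)"
      using Y_le[OF s] by (simp add: algebra_simps)
    show "(Y has_vector_derivative Y' s) (at s within {0..t})"
      by (rule Y[OF s])
  next
    show "0 \<le> b * (1 + sqrt M) * e"
      using \<open>0 \<le> b\<close> \<open>0 < e\<close> real_sqrt_ge_zero[OF M] by simp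
  qed fact+
  then show "norm (Y t) \<le> exp (C / m) * b * (1 + sqrt M) / a * e" by (simp add: ac_simps)
qed

section \<open>Matrices with the Frobenius norm\<close>

lemma norm_sq_vec: "(norm (x :: 'a::real_inner ^ 'n::finite))\<^sup>2 = (\<Sum>i\<in>UNIV. (norm (x $ i))\<^sup>2)"
  by (simp add: power2_norm_eq_inner inner_vec_def)

lemma inner_transpose: "A\<^sup>\<top> \<bullet> B\<^sup>\<top> = A \<bullet> (B :: real ^ 'n::finite ^ 'm::finite)"
  by (simp add: inner_vec_def transpose_def) (rule sum.swap)

lemma norm_transpose [simp]: "norm (A\<^sup>\<top>) = norm (A :: real ^ 'n::finite ^ 'm::finite)"
  by (simp add: norm_eq_sqrt_inner inner_transpose)

lemma norm_matrix_mult_le: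
  fixes A :: "real ^ 'n::finite ^ 'm::finite" and B :: "real ^ 'p::finite ^ 'n"
  shows "norm (A ** B) \<le> norm A * norm B"
proof (rule power2_le_imp_le)
  have "(norm (A ** B))\<^sup>2 = (\<Sum>i\<in>UNIV. \<Sum>j\<in>UNIV. (A $ i \<bullet> B\<^sup>\<top> $ j)\<^sup>2)"
    by (simp add: norm_sq_vec matrix_matrix_mult_def inner_vec_def transpose_def)
  also have "\<dots> \<le> (\<Sum>i\<in>UNIV. \<Sum>j\<in>UNIV. (norm (A $ i))\<^sup>2 * (norm (B\<^sup>\<top> $ j))\<^sup>2)"
    using Cauchy_Schwarz_ineq by (intro sum_mono) (auto simp: power2_norm_eq_inner)
  also have "\<dots> = (norm A)\<^sup>2 * (norm (B\<^sup>\<top>))\<^sup>2"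
    by (simp only: norm_sq_vec[of A] norm_sq_vec[of "B\<^sup>\<top>"] sum_product)
  finally show "(norm (A ** B))\<^sup>2 \<le> (norm A * norm B)\<^sup>2"
    by (simp add: power_mult_distrib)
qed simp

lemma norm_mult3_le:
  fixes A :: "real ^ 'n::finite ^ 'm::finite" and B :: "real ^ 'p::finite ^ 'n" and C :: "real ^ 'q::finite ^ 'p"
  shows "norm (A ** B ** C) \<le> norm A * norm B * norm C"
  using norm_matrix_mult_le[of "A ** B" C] norm_matrix_mult_le[of A B]
  by (meson mult_right_mono norm_ge_zero order_trans)

lemma bounded_bilinear_matrix_mult:
  "bounded_bilinear ((**) :: real ^ 'n::finite ^ 'm::finite \<Rightarrow> real ^ 'p::finite ^ 'n \<Rightarrow> real ^ 'p ^ 'm)"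
proof
  show "\<exists>K. \<forall>(A :: real ^ 'n ^ 'm) (B :: real ^ 'p ^ 'n). norm (A ** B) \<le> norm A * norm B * K"
    by (rule exI[of _ 1]) (simp add: norm_matrix_mult_le)
qed (simp_all add: matrix_matrix_mult_def vec_eq_iff distrib_left distrib_right sum.distrib sum_distrib_left ac_simps)

lemma bounded_linear_transpose: "bounded_linear (transpose :: real ^ 'n::finite ^ 'm::finite \<Rightarrow> real ^ 'm ^ 'n)"
proof (rule bounded_linear_intro)
  show "norm (x\<^sup>\<top>) \<le> norm x * 1" for x :: "real ^ 'n ^ 'm" by simp
qed (simp_all add: transpose_def vec_eq_iff)

text \<open>
  Rewriting with these rules expands a matrix expression into a sum of left-associated products.
\<close>

lemmas matrix_mult_algebra =
  bounded_bilinear.add_left[OF bounded_bilinear_matrix_mult]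
  bounded_bilinear.add_right[OF bounded_bilinear_matrix_mult]
  bounded_bilinear.diff_left[OF bounded_bilinear_matrix_mult]
  bounded_bilinear.diff_right[OF bounded_bilinear_matrix_mult]
  bounded_bilinear.minus_left[OF bounded_bilinear_matrix_mult]
  bounded_bilinear.minus_right[OF bounded_bilinear_matrix_mult]
  bounded_bilinear.zero_left[OF bounded_bilinear_matrix_mult]
  bounded_bilinear.zero_right[OF bounded_bilinear_matrix_mult]
  bounded_bilinear.scaleR_left[OF bounded_bilinear_matrix_mult]
  bounded_bilinear.scaleR_right[OF bounded_bilinear_matrix_mult]
  matrix_mul_assoc

lemmas transpose_algebra =
  linear_add[OF bounded_linear.linear[OF bounded_linear_transpose]]
  linear_diff[OF bounded_linear.linear[OF bounded_linear_transpose]]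
  linear_neg[OF bounded_linear.linear[OF bounded_linear_transpose]]
  linear_scale[OF bounded_linear.linear[OF bounded_linear_transpose]]
  linear_0[OF bounded_linear.linear[OF bounded_linear_transpose]]
  matrix_transpose_mul transpose_transpose

lemmas lipschitz_on_balls_matrix_mult [lipschitz_on_balls_intros] = lipschitz_on_balls_bilinear[OF bounded_bilinear_matrix_mult]

lemmas lipschitz_on_balls_transpose [lipschitz_on_balls_intros] = lipschitz_on_balls_linear_compose[OF bounded_linear_transpose]

lemma inner_mult_le: "X \<bullet> (A ** B) \<le> norm X * (norm A * norm (B :: real ^ 'n::finite ^ 'k::finite))"
  using norm_cauchy_schwarz[of X "A ** B"] norm_matrix_mult_le[of A B]
  by (meson mult_left_mono norm_ge_zero order_trans)

lemma dissipative_quadratic_form: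
  assumes "sym_part G \<preceq> c *\<^sub>R mat 1"
  shows "x \<bullet> (G *v x) \<le> c * (norm x)\<^sup>2"
proof -
  have "0 \<le> x \<bullet> ((c *\<^sub>R mat 1 - (1/2) *\<^sub>R (G\<^sup>\<top> + G)) *v x)"
    using assms by (simp add: loewner_le_def sym_part_def)
  also have "\<dots> = c * (x \<bullet> x) - (1/2) * (x \<bullet> (x v* G) + x \<bullet> (G *v x))"
    by (simp add: matrix_vector_mult_diff_rdistrib matrix_vector_mult_add_rdistrib
        scaleR_matrix_vector_assoc[symmetric] inner_diff_right inner_add_right)
  also have "x \<bullet> (x v* G) = x \<bullet> (G *v x)"
    by (simp add: dot_lmul_matrix[symmetric] inner_commute)
  finally show ?thesis by (simp add: power2_norm_eq_inner)
qed

text \<open>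
  The Frobenius inner product is the sum over the rows, so a bound on the symmetric part of \<open>G\<close> acts row by row
  on \<open>E\<close>.
\<close>

lemma inner_mult_right_le:
  fixes E :: "real ^ 'n::finite ^ 'm::finite"
  assumes "sym_part G \<preceq> c *\<^sub>R mat 1"
  shows "E \<bullet> (E ** G) \<le> c * (norm E)\<^sup>2"
proof -
  have row: "x \<bullet> (x v* G) \<le> c * (norm x)\<^sup>2" for x
    using dissipative_quadratic_form[OF assms, of x]
    by (simp add: dot_lmul_matrix[symmetric] inner_commute)
  have "E \<bullet> (E ** G) = (\<Sum>i\<in>UNIV. E $ i \<bullet> (E $ i v* G))"
    by (simp add: inner_vec_def matrix_matrix_mult_def vector_matrix_mult_def ac_simps)
  also have "\<dots> \<le> (\<Sum>i\<in>UNIV. c * (norm (E $ i))\<^sup>2)"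
    by (intro sum_mono row)
  finally show ?thesis by (simp add: norm_sq_vec[of E] sum_distrib_left)
qed

lemma inner_mult_left_le:
  fixes E :: "real ^ 'm::finite ^ 'n::finite"
  assumes "sym_part G \<preceq> c *\<^sub>R mat 1"
  shows "E \<bullet> (G\<^sup>\<top> ** E) \<le> c * (norm E)\<^sup>2"
proof -
  have "E \<bullet> (G\<^sup>\<top> ** E) = E\<^sup>\<top> \<bullet> (E\<^sup>\<top> ** G)"
    using inner_transpose[of E "G\<^sup>\<top> ** E"] by (simp add: transpose_algebra)
  then show ?thesis using inner_mult_right_le[OF assms, of "E\<^sup>\<top>"] by simp
qed

lemma dissipative_invertible:
  fixes G :: "real ^ 'n::finite ^ 'n"
  assumes "sym_part G \<preceq> c *\<^sub>R mat 1" "c < 0"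
  shows "invertible G"
  unfolding invertible_left_inverse matrix_left_invertible_ker
proof (intro allI impI)
  fix x assume "G *v x = 0"
  then have "0 \<le> c * (norm x)\<^sup>2" using dissipative_quadratic_form[OF assms(1), of x] by simp
  then show "x = 0" using \<open>c < 0\<close> by (simp add: zero_le_mult_iff)
qed

lemma matrix_inv_mult:
  assumes "invertible (A :: real ^ 'n::finite ^ 'n)"
  shows "A ** matrix_inv A = mat 1" "matrix_inv A ** A = mat 1"
    "X ** A ** matrix_inv A = X" "X ** matrix_inv A ** A = X"
proof -
  show 1: "A ** matrix_inv A = mat 1" and 2: "matrix_inv A ** A = mat 1"
    using someI_ex[OF assms[unfolded invertible_def]] by (simp_all add: matrix_inv_def)
  show "X ** A ** matrix_inv A = X" "X ** matrix_inv A ** A = X"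
    using 1 2 by (simp_all flip: matrix_mul_assoc)
qed

lemma matrix_inv_eqI:
  fixes A B :: "real ^ 'n::finite ^ 'n"
  assumes "A ** B = mat 1"
  shows "matrix_inv A = B"
proof -
  have "invertible A" using assms invertible_right_inverse by blast
  then have "matrix_inv A ** (A ** B) = B"
    by (simp add: matrix_mul_assoc matrix_inv_mult)
  then show ?thesis using assms by simp
qed

lemma bounded_linear_sym_part: "bounded_linear (sym_part :: real ^ 'n::finite ^ 'n \<Rightarrow> _)"
  unfolding sym_part_def
  by (intro bounded_linear_intros bounded_linear_add bounded_linear_transpose bounded_linear_ident
      bounded_linear_compose[OF bounded_linear_scaleR_right])

lemmas lipschitz_on_balls_sym_part [lipschitz_on_balls_intros] = lipschitz_on_balls_linear_compose[OF bounded_linear_sym_part]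

lemma sym_part_in_Sym: "sym_part M \<in> Sym"
  by (simp add: Sym_def sym_part_def transpose_algebra add.commute)

lemma sym_part_eq: "M \<in> Sym \<Longrightarrow> sym_part M = M"
  by (simp add: Sym_def sym_part_def flip: scaleR_2)

lemma Sym_preserved:
  assumes Z: "\<And>s. s \<in> {0..t} \<Longrightarrow> (Z has_vector_derivative Z' s) (at s within {0..t})"
    and "\<And>s. s \<in> {0..t} \<Longrightarrow> Z' s \<in> Sym" and "Z 0 \<in> Sym" and s: "s \<in> {0..t}"
  shows "Z s \<in> Sym"
proof -
  have "\<exists>c. \<forall>s\<in>{0..t}. (Z s)\<^sup>\<top> - Z s = c"
  proof (rule has_derivative_zero_constant)
    fix s assume s: "s \<in> {0..t}"
    have "((\<lambda>s. (Z s)\<^sup>\<top> - Z s) has_vector_derivative (Z' s)\<^sup>\<top> - Z' s) (at s within {0..t})"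
      by (intro derivative_intros Z[OF s] bounded_linear.has_vector_derivative[OF bounded_linear_transpose])
    then show "((\<lambda>s. (Z s)\<^sup>\<top> - Z s) has_derivative (\<lambda>h. 0)) (at s within {0..t})"
      using assms(2)[OF s] by (simp add: has_vector_derivative_def Sym_def)
  qed simp
  then have "(Z s)\<^sup>\<top> - Z s = (Z 0)\<^sup>\<top> - Z 0"
    using s by (metis atLeastAtMost_iff order.trans order_refl)
  then show ?thesis using \<open>Z 0 \<in> Sym\<close> by (simp add: Sym_def)
qed

lemma norm_less_if_interior_sym_cball:
  fixes M :: "real ^ 'n::finite ^ 'n"
  assumes "M \<in> top_of_set Sym interior_of sym_cball q"
  shows "norm M < q"
proof -
  obtain V where V: "open V" "M \<in> V" "M \<in> Sym" "Sym \<inter> V \<subseteq> sym_cball q"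
    using assms unfolding interior_of_def openin_open by auto
  obtain d where d: "0 < d" "ball M d \<subseteq> V"
    using V(1,2) open_contains_ball by blast
  \<comment> \<open>Moving outwards from \<open>M\<close> within the interior stays in the ball, so the norm of
    \<open>M\<close> is less than \<open>q\<close>; the direction of \<open>0\<close> is arbitrary.\<close>
  define u where "u = (if M = 0 then mat 1 else M)"
  have "(mat 1 :: real ^ 'n ^ 'n) \<noteq> 0" by (simp add: vec_eq_iff mat_def)
  then have u: "0 < norm u" by (simp add: u_def)
  define t where "t = d / (2 * norm u)"
  have t: "0 < t" "t * norm u < d" using d u by (simp_all add: t_def)
  have "M + t *\<^sub>R u \<in> Sym"
    using V(3) by (simp add: Sym_def u_def transpose_algebra)
  moreover have "M + t *\<^sub>R u \<in> V" using d(2) t by (auto simp: dist_norm)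
  ultimately have "norm (M + t *\<^sub>R u) \<le> q" using V(4) by (auto simp: sym_cball_def)
  moreover have "norm (M + t *\<^sub>R u) = norm M + t * norm u"
  proof (cases "M = 0")
    case False
    then have "M + t *\<^sub>R u = (1 + t) *\<^sub>R M" by (simp add: u_def scaleR_add_left)
    then show ?thesis using False t by (simp add: u_def distrib_right)
  qed (use t in simp)
  ultimately show ?thesis using t u by (smt (verit) mult_pos_pos)
qed

section \<open>The functions of the full system\<close>

lemma Delta1_transpose: "(Delta1 D)\<^sup>\<top> = Delta1 D"
  by (simp add: Delta1_def transpose_algebra)

lemma Delta2_transpose: "(Delta2 D)\<^sup>\<top> = Delta2 D"
  by (simp add: Delta2_def transpose_algebra)

lemma lipschitz_on_balls_f:
  assumes "lipschitz_on_balls X" "lipschitz_on_balls Y" "lipschitz_on_balls Z" "lipschitz_on_balls E"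
  shows "lipschitz_on_balls (\<lambda>u. f D (X u) (Y u) (Z u) (E u))"
  unfolding f_def by (intro lipschitz_on_balls_intros assms)

lemma lipschitz_on_balls_g1:
  assumes "lipschitz_on_balls X" "lipschitz_on_balls Y" "lipschitz_on_balls Z" "lipschitz_on_balls E"
  shows "lipschitz_on_balls (\<lambda>u. g1 D (X u) (Y u) (Z u) (E u))"
  unfolding g1_def by (intro lipschitz_on_balls_intros assms)

lemma lipschitz_on_balls_g2:
  assumes "lipschitz_on_balls X" "lipschitz_on_balls Y" "lipschitz_on_balls Z" "lipschitz_on_balls E"
  shows "lipschitz_on_balls (\<lambda>u. g2 D (X u) (Y u) (Z u) (E u))"
  unfolding g2_def power2_eq_square by (intro lipschitz_on_balls_intros lipschitz_on_balls_mult_real assms)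

lemma f_in_Sym:
  assumes "Q1 D \<in> Sym" "x \<in> Sym"
  shows "f D x y z e \<in> Sym"
  using assms by (simp add: Sym_def f_def transpose_algebra Delta1_transpose Delta2_transpose matrix_mul_assoc ac_simps)

lemma g2_in_Sym:
  assumes "Q2 D \<in> Sym" "z \<in> Sym"
  shows "g2 D x y z e \<in> Sym"
  using assms by (simp add: Sym_def g2_def transpose_algebra Delta1_transpose Delta2_transpose matrix_mul_assoc ac_simps)

lemma f_only_depends_on_P11_P12: "f D x y z e = f D x y z' e'"
  by (simp add: f_def)

definition g1_remainder where
  "g1_remainder D x y = (A11 D)\<^sup>\<top> ** y + x ** Delta1 D ** y + y ** (Delta D)\<^sup>\<top> ** y"

definition g2_remainder where
  "g2_remainder D y z e = (A12 D)\<^sup>\<top> ** y + y\<^sup>\<top> ** A12 D + e *\<^sub>R (y\<^sup>\<top> ** Delta1 D ** y)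
     + y\<^sup>\<top> ** Delta D ** z + z ** (Delta D)\<^sup>\<top> ** y"

lemma g1_eps: "g1 D x y z e = g1 D x y z 0 + e *\<^sub>R g1_remainder D x y"
  by (simp add: g1_def g1_remainder_def scaleR_add_right)

lemma g2_eps: "g2 D x y z e = g2 D x' y' z 0 + e *\<^sub>R g2_remainder D y z e"
  by (simp add: g2_def g2_remainder_def scaleR_add_right power2_eq_square)

section \<open>The reduced Riccati equation\<close>

text \<open>
  The algebraic data of the fast variables: \<open>Pb\<close> is the stabilising solution of the algebraic Riccati equation,
  and \<open>\<gamma>\<close> the resulting rate of dissipation.
\<close>

locale stable_layer =
  fixes D :: "('n1::finite, 'n2::finite, 'k1::finite, 'k2::finite) riccati_data"
    and Pb :: "real ^ 'n2 ^ 'n2" and \<gamma> :: real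
  assumes Q1: "Q1 D \<in> Sym" and Q2: "Q2 D \<in> Sym"
    and Delta2_inv: "invertible (Delta2 D)"
    and Pb: "Pb \<in> Sym"
    and are: "(A22 D)\<^sup>\<top> ** Pb + Pb ** A22 D + Pb ** Delta2 D ** Pb + Q2 D = 0"
    and \<gamma>: "0 < \<gamma>" and S_le: "sym_part (Smat D Pb) \<preceq> (- \<gamma>) *\<^sub>R mat 1"

begin

abbreviation S where "S \<equiv> Smat D Pb"

abbreviation h where "h \<equiv> hfun D Pb"

lemma S_inv: "invertible S"
  using dissipative_invertible[OF S_le] \<gamma> by simp

lemma h_mult_S: "h P ** S = - ((A21 D)\<^sup>\<top> ** Pb + P ** A12 D + P ** Delta D ** Pb)"
  by (simp add: hfun_def Smat_def[symmetric] matrix_mult_algebra matrix_inv_mult[OF S_inv])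

lemma S_transpose: "S\<^sup>\<top> = (A22 D)\<^sup>\<top> + Pb ** Delta2 D"
  using Pb by (simp add: Smat_def transpose_algebra Delta2_transpose Sym_def)

text \<open>
  The algebraic Riccati equation for \<open>Pb\<close> says that \<open>Lambda D = S\<^sup>\<top> ** matrix_inv (Delta2 D) ** S\<close>.
\<close>

lemma Lambda_inv: "matrix_inv (Lambda D) = matrix_inv S ** Delta2 D ** (matrix_inv S)\<^sup>\<top>"
proof (rule matrix_inv_eqI)
  note inv = matrix_inv_mult[OF Delta2_inv] matrix_inv_mult[OF S_inv]
  have "Lambda D = S\<^sup>\<top> ** matrix_inv (Delta2 D) ** S"
  proof -
    have "Q2 D = - ((A22 D)\<^sup>\<top> ** Pb + Pb ** A22 D + Pb ** Delta2 D ** Pb)"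
      using are unfolding eq_neg_iff_add_eq_0 by (simp add: ac_simps)
    then show ?thesis
      unfolding Lambda_def S_transpose unfolding Smat_def
      by (simp add: matrix_mult_algebra inv)
  qed
  moreover have "S\<^sup>\<top> ** (matrix_inv S)\<^sup>\<top> = mat 1"
    using inv(6) by (simp flip: matrix_transpose_mul)
  ultimately show "Lambda D ** (matrix_inv S ** Delta2 D ** (matrix_inv S)\<^sup>\<top>) = mat 1"
    by (simp add: matrix_mul_assoc inv)
qed

text \<open>
  Substituting the quasi-steady state \<open>h P\<close> of the fast variable into the slow equation gives the reduced
  Riccati equation. With \<open>U\<close> and \<open>W\<close> as below, \<open>h P = W ** matrix_inv S - U ** matrix_inv (Delta2 D)\<close>, and the terms
  containing \<open>h P\<close> become the difference of two squares in \<open>W\<close> and \<open>U\<close>.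
\<close>

lemma reduced_vector_field:
  assumes P: "P \<in> Sym"
  shows "f D P (h P) z e = (Atilde D)\<^sup>\<top> ** P + P ** Atilde D + P ** Mmat D ** P + Nmat D"
proof -
  define V where "V = matrix_inv (Delta2 D)"
  define S' where "S' = matrix_inv S"
  define \<Lambda>' where "\<Lambda>' = matrix_inv (Lambda D)"
  define U where "U = (A21 D)\<^sup>\<top> + P ** Delta D"
  define W where "W = U ** V ** A22 D - P ** A12 D"
  have V: "Delta2 D ** V = mat 1" "V ** Delta2 D = mat 1" "\<And>X :: real ^ 'n2 ^ 'n1. X ** Delta2 D ** V = X"
      "\<And>X :: real ^ 'n2 ^ 'n1. X ** V ** Delta2 D = X"
    using matrix_inv_mult[OF Delta2_inv] by (simp_all add: V_def)
  have S': "\<And>X :: real ^ 'n2 ^ 'n1. X ** S' ** S = X" "\<And>X :: real ^ 'n2 ^ 'n1. X ** S ** S' = X"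
    using matrix_inv_mult[OF S_inv] by (simp_all add: S'_def)
  have Vt: "V\<^sup>\<top> = V"
  proof -
    have "Delta2 D ** V\<^sup>\<top> = mat 1"
      using arg_cong[OF V(2), of transpose] by (simp add: transpose_algebra Delta2_transpose)
    then have "V ** (Delta2 D ** V\<^sup>\<top>) = V" by simp
    then show ?thesis by (simp add: matrix_mul_assoc V)
  qed
  have \<Lambda>': "\<Lambda>' = S' ** Delta2 D ** S'\<^sup>\<top>" unfolding \<Lambda>'_def S'_def by (rule Lambda_inv)
  have \<Lambda>'t: "\<Lambda>'\<^sup>\<top> = \<Lambda>'"
    by (simp add: \<Lambda>' transpose_algebra Delta2_transpose matrix_mul_assoc)
  have h: "h P = W ** S' - U ** V"
  proof -
    have "h P ** S = (W ** S' - U ** V) ** S"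
      unfolding h_mult_S by (simp add: matrix_mult_algebra S') (simp add: W_def U_def Smat_def matrix_mult_algebra V)
    then have "h P ** S ** S' = (W ** S' - U ** V) ** S ** S'" by simp
    then show ?thesis unfolding S' .
  qed
  have Pt: "P\<^sup>\<top> = P" using P by (simp add: Sym_def)
  have f_eq: "f D P (h P) z e = (A11 D)\<^sup>\<top> ** P + P ** A11 D + P ** Delta1 D ** P + Q1 D
      + (h P ** U\<^sup>\<top> + U ** (h P)\<^sup>\<top> + h P ** Delta2 D ** (h P)\<^sup>\<top>)"
    by (simp add: f_def U_def matrix_mult_algebra transpose_algebra Pt)
  \<comment> \<open>Completing the square in \<open>h P + U ** V\<close>: this is where the bracket of the
    reduced coefficients comes from.\<close>
  have square: "h P ** U\<^sup>\<top> + U ** (h P)\<^sup>\<top> + h P ** Delta2 D ** (h P)\<^sup>\<top>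
      = W ** \<Lambda>' ** W\<^sup>\<top> - U ** V ** U\<^sup>\<top>"
    unfolding h \<Lambda>' by (simp add: matrix_mult_algebra transpose_algebra Vt V)
  show ?thesis
    unfolding f_eq square
    unfolding Atilde_def Mmat_def Nmat_def V_def[symmetric] \<Lambda>'_def[symmetric] W_def U_def
    by (simp add: matrix_mult_algebra transpose_algebra Vt V \<Lambda>'t Pt Delta2_transpose)
qed

section \<open>The boundary layer\<close>

lemma g1_layer:
  "g1 D 0 (y + h 0) (z + Pb) 0 = y ** (S + Delta2 D ** z) + ((A21 D)\<^sup>\<top> + h 0 ** Delta2 D) ** z"
proof -
  have "h 0 ** S = - ((A21 D)\<^sup>\<top> ** Pb)" by (simp add: h_mult_S matrix_mult_algebra)
  then have "h 0 ** A22 D = - ((A21 D)\<^sup>\<top> ** Pb) - h 0 ** Delta2 D ** Pb"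
    by (simp add: Smat_def matrix_mult_algebra eq_diff_eq)
  then show ?thesis
    by (simp add: g1_def Smat_def matrix_mult_algebra)
qed

lemma g2_layer: "g2 D x y (z + Pb) 0 = S\<^sup>\<top> ** z + z ** S + z ** Delta2 D ** z"
proof -
  have "g2 D x y (z + Pb) 0 = S\<^sup>\<top> ** z + z ** S + z ** Delta2 D ** z
      + ((A22 D)\<^sup>\<top> ** Pb + Pb ** A22 D + Pb ** Delta2 D ** Pb + Q2 D)"
    unfolding S_transpose by (simp add: g2_def Smat_def matrix_mult_algebra)
  then show ?thesis by (simp add: are)
qed

text \<open>
  The boundary-layer vector field, with the second component replaced by its symmetric part. The field is then
  symmetric in that component, so solutions with symmetric initial values remain symmetric.
\<close>

definition layer_field :: "(real ^ 'n2 ^ 'n1) \<times> (real ^ 'n2 ^ 'n2) \<Rightarrow> (real ^ 'n2 ^ 'n1) \<times> (real ^ 'n2 ^ 'n2)" where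
  "layer_field u = (g1 D 0 (fst u + h 0) (sym_part (snd u) + Pb) 0, g2 D 0 (fst u + h 0) (sym_part (snd u) + Pb) 0)"

lemma lipschitz_on_balls_layer_field: "lipschitz_on_balls layer_field"
  unfolding layer_field_def by (intro lipschitz_on_balls_intros lipschitz_on_balls_g1 lipschitz_on_balls_g2)

lemma layer_solution_imp_ode:
  assumes "boundary_layer_solution D Pb Y Z"
  shows "ode_on layer_field t (\<lambda>s. (Y s, Z s))"
  unfolding ode_on_def
proof
  fix s assume s: "s \<in> {0..t}"
  then have "Z s \<in> Sym" using assms by (auto simp: boundary_layer_solution_def)
  moreover have "((\<lambda>s. (Y s, Z s)) has_vector_derivative
      (g1 D 0 (Y s + h 0) (Z s + Pb) 0, g2 D 0 (Y s + h 0) (Z s + Pb) 0)) (at s within {0..t})"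
    using assms s unfolding boundary_layer_solution_def
    by (intro has_vector_derivative_Pair) (auto intro: has_vector_derivative_within_subset)
  ultimately show "((\<lambda>s. (Y s, Z s)) has_vector_derivative layer_field (Y s, Z s)) (at s within {0..t})"
    by (simp add: layer_field_def sym_part_eq)
qed

lemma layer_solution_unique:
  assumes "boundary_layer_solution D Pb Y Z" "boundary_layer_solution D Pb Y' Z'" "0 \<le> s"
  shows "Y s = Y' s" "Z s = Z' s"
proof -
  have "(Y s, Z s) = (Y' s, Z' s)"
    using ode_unique[OF lipschitz_on_balls_layer_field layer_solution_imp_ode[OF assms(1), of s]
        layer_solution_imp_ode[OF assms(2), of s], of s] assms
    by (simp add: boundary_layer_solution_def)
  then show "Y s = Y' s" "Z s = Z' s" by simp_all
qed

lemma layer_dissipative: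
  assumes "z \<in> Sym" "sym_part (S + Delta2 D ** z) \<preceq> \<delta> *\<^sub>R mat 1"
  shows "z \<bullet> (S\<^sup>\<top> ** z + z ** S + z ** Delta2 D ** z) \<le> - (\<gamma> - \<delta>) * (norm z)\<^sup>2"
proof -
  define G where "G = S + Delta2 D ** z"
  have zt: "z\<^sup>\<top> = z" using assms by (simp add: Sym_def)
  \<comment> \<open>The vector field is the mean of those with the coefficients \<open>S\<close> and \<open>S +
    Delta2 D ** z\<close>: the rate \<open>\<gamma>\<close> of one outweighs the growth \<open>\<delta>\<close>
    of the other.\<close>
  have "2 * (z \<bullet> (S\<^sup>\<top> ** z + z ** S + z ** Delta2 D ** z))
      = z \<bullet> (S\<^sup>\<top> ** z) + z \<bullet> (z ** S) + z \<bullet> (G\<^sup>\<top> ** z) + z \<bullet> (z ** G)"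
    by (simp add: G_def transpose_algebra matrix_mult_algebra Delta2_transpose zt inner_add_right)
  also have "\<dots> \<le> - \<gamma> * (norm z)\<^sup>2 + - \<gamma> * (norm z)\<^sup>2 + \<delta> * (norm z)\<^sup>2 + \<delta> * (norm z)\<^sup>2"
    using assms(2) by (intro add_mono inner_mult_left_le inner_mult_right_le S_le) (simp_all add: G_def)
  finally show ?thesis by (simp add: algebra_simps)
qed

text \<open>
  The second component decays at a rate controlled by \<open>\<gamma> - \<delta>\<close> as long as it stays in the ball of radius \<open>q\<close>,
  and since it starts strictly inside, it never leaves. The first component then solves a linear equation with
  coefficient \<open>S + Delta2 D ** Z\<close>, which tends to the stable matrix \<open>S\<close>, and with forcing that decays with \<open>Z\<close>.
\<close>

lemma boundary_layer_exists:
  assumes "\<delta> < \<gamma>" and ball: "\<And>z. z \<in> Sym \<Longrightarrow> norm z \<le> q \<Longrightarrow> sym_part (S + Delta2 D ** z) \<preceq> \<delta> *\<^sub>R mat 1"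
    and Pb_less: "norm Pb < q"
  obtains Y Z m K where "boundary_layer_solution D Pb Y Z" "0 < m" "0 \<le> K"
    "\<And>s. 0 \<le> s \<Longrightarrow> norm (Y s) \<le> K * exp (- m * s)" "\<And>s. 0 \<le> s \<Longrightarrow> norm (Z s) \<le> K * exp (- m * s)"
proof -
  define w where "w = (\<gamma> - \<delta>) / 2"
  define p where "p = norm Pb"
  define B where "B = (A21 D)\<^sup>\<top> + h 0 ** Delta2 D"
  define C where "C = norm (Delta2 D) * p"
  define c where "c = norm B * p"
  define K where "K = sqrt (exp (2 * C / w) * ((norm (h 0))\<^sup>2 + c\<^sup>2 / (\<gamma> * w)))"
  define m where "m = min \<gamma> w / 2"
  \<comment> \<open>The tube for the first component has to contain the initial value, and its boundary must be
    out of reach of a solution bounded by \<open>K\<close>.\<close>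
  define K' where "K' = max K (norm (h 0)) + 1"
  have w: "0 < w" using \<open>\<delta> < \<gamma>\<close> by (simp add: w_def)
  have m: "0 < m" "m \<le> w" using w \<gamma> by (auto simp: m_def)
  have p: "0 \<le> p" and C: "0 \<le> C" and c: "0 \<le> c" by (simp_all add: p_def C_def c_def)
  have K: "0 \<le> K" using w \<gamma> by (simp add: K_def)
  \<comment> \<open>A priori estimate on any interval on which the second component has not left the ball of
    radius \<open>q\<close>.\<close>
  have decay: "snd (u t) \<in> Sym" "norm (snd (u t)) \<le> p * exp (- w * t)" "norm (fst (u t)) \<le> K * exp (- m * t)"
    if "0 \<le> t" and u0: "u 0 = (- h 0, - Pb)" and u: "ode_on layer_field t u"
      and le: "\<And>s. s \<in> {0..t} \<Longrightarrow> norm (snd (u s)) \<le> q" for u t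
  proof -
    define Y where "Y s = fst (u s)" for s
    define Z where "Z s = snd (u s)" for s
    have Y: "(Y has_vector_derivative g1 D 0 (Y s + h 0) (sym_part (Z s) + Pb) 0) (at s within {0..t})"
      and Z: "(Z has_vector_derivative g2 D 0 (Y s + h 0) (sym_part (Z s) + Pb) 0) (at s within {0..t})"
      if "s \<in> {0..t}" for s
      using has_vector_derivative_fst[OF ode_onD[OF u that]] has_vector_derivative_snd[OF ode_onD[OF u that]]
      by (simp_all add: Y_def[abs_def] Z_def[abs_def] layer_field_def)
    have Zsym: "Z s \<in> Sym" if "s \<in> {0..t}" for s
    proof (rule Sym_preserved[OF Z _ _ that])
      show "Z 0 \<in> Sym" using Pb by (simp add: Z_def u0 Sym_def transpose_algebra)
      have "sym_part (Z s) + Pb \<in> Sym" for s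
        using sym_part_in_Sym[of "Z s"] Pb by (simp add: Sym_def transpose_algebra)
      then show "g2 D 0 (Y s + h 0) (sym_part (Z s) + Pb) 0 \<in> Sym" for s
        by (intro g2_in_Sym Q2)
    qed
    have Z_le: "norm (Z s) \<le> p * exp (- w * s)" if s: "s \<in> {0..t}" for s
    proof -
      have "norm (Z s) \<le> sqrt (exp (2 * 0 / (\<gamma> - \<delta>)) * ((norm (Z 0))\<^sup>2 + 0\<^sup>2 / ((\<gamma> - \<delta>) * (\<gamma> - \<delta>))))
          * exp (- (min (\<gamma> - \<delta>) (\<gamma> - \<delta>) / 2) * s)"
      proof (rule exponential_decay[where Y' = "\<lambda>s. g2 D 0 (Y s + h 0) (sym_part (Z s) + Pb) 0"])
        fix r assume "r \<in> {0..s}"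
        then have r: "r \<in> {0..t}" using s by simp
        show "(Z has_vector_derivative g2 D 0 (Y r + h 0) (sym_part (Z r) + Pb) 0) (at r within {0..s})"
          using s by (intro has_vector_derivative_within_subset[OF Z[OF r]]) simp
        have "Z r \<bullet> g2 D 0 (Y r + h 0) (sym_part (Z r) + Pb) 0 \<le> - (\<gamma> - \<delta>) * (norm (Z r))\<^sup>2"
          unfolding sym_part_eq[OF Zsym[OF r]] g2_layer
          using le[OF r] by (intro layer_dissipative Zsym[OF r] ball) (simp_all add: Z_def)
        then show "Z r \<bullet> g2 D 0 (Y r + h 0) (sym_part (Z r) + Pb) 0
            \<le> (- (\<gamma> - \<delta>) + 0 * exp (- (\<gamma> - \<delta>) * r)) * (norm (Z r))\<^sup>2 + 0 * exp (- (\<gamma> - \<delta>) * r) * norm (Z r)"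
          by simp
      qed (use s \<open>\<delta> < \<gamma>\<close> in auto)
      then show ?thesis by (simp add: Z_def u0 p_def w_def)
    qed
    have "norm (Y t) \<le> sqrt (exp (2 * C / w) * ((norm (Y 0))\<^sup>2 + c\<^sup>2 / (\<gamma> * w))) * exp (- (min \<gamma> w / 2) * t)"
    proof (rule exponential_decay[OF \<open>0 \<le> t\<close> \<gamma> w C c Y])
      fix s assume s: "s \<in> {0..t}"
      define n where "n = norm (Y s)"
      define x where "x = exp (- w * s)"
      have zx: "norm (Z s) \<le> p * x" using Z_le[OF s] by (simp add: x_def)
      have n: "0 \<le> n" by (simp add: n_def)
      have "Y s \<bullet> g1 D 0 (Y s + h 0) (sym_part (Z s) + Pb) 0
          = Y s \<bullet> (Y s ** S) + Y s \<bullet> (Y s ** Delta2 D ** Z s) + Y s \<bullet> (B ** Z s)"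
        by (simp add: sym_part_eq[OF Zsym[OF s]] g1_layer B_def matrix_mult_algebra inner_add_right)
      also have "\<dots> \<le> - \<gamma> * n\<^sup>2 + n * (n * norm (Delta2 D) * (p * x)) + n * (norm B * (p * x))"
      proof (intro add_mono)
        show "Y s \<bullet> (Y s ** S) \<le> - \<gamma> * n\<^sup>2"
          unfolding n_def by (rule inner_mult_right_le[OF S_le])
        have "norm (Y s ** Delta2 D ** Z s) \<le> n * norm (Delta2 D) * (p * x)"
          using norm_mult3_le[of "Y s" "Delta2 D" "Z s"] mult_left_mono[OF zx, of "n * norm (Delta2 D)"] n
          by (simp add: n_def)
        then show "Y s \<bullet> (Y s ** Delta2 D ** Z s) \<le> n * (n * norm (Delta2 D) * (p * x))"
          using norm_cauchy_schwarz[of "Y s" "Y s ** Delta2 D ** Z s"] mult_left_mono[of _ _ n] n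
          unfolding n_def by (meson order_trans)
        have "norm B * norm (Z s) \<le> norm B * (p * x)" using zx by (intro mult_left_mono) auto
        then show "Y s \<bullet> (B ** Z s) \<le> n * (norm B * (p * x))"
          using inner_mult_le[of "Y s" B "Z s"] mult_left_mono[of _ _ n] n
          unfolding n_def by (meson order_trans)
      qed
      also have "\<dots> = (- \<gamma> + C * x) * n\<^sup>2 + c * x * n"
        by (simp add: C_def c_def algebra_simps power2_eq_square)
      finally show "Y s \<bullet> g1 D 0 (Y s + h 0) (sym_part (Z s) + Pb) 0
          \<le> (- \<gamma> + C * exp (- w * s)) * (norm (Y s))\<^sup>2 + c * exp (- w * s) * norm (Y s)"
        by (simp only: n_def x_def)
    qed
    then show "norm (fst (u t)) \<le> K * exp (- m * t)" by (simp add: Y_def u0 K_def m_def)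
    show "snd (u t) \<in> Sym" "norm (snd (u t)) \<le> p * exp (- w * t)"
      using Zsym[of t] Z_le[of t] \<open>0 \<le> t\<close> by (simp_all add: Z_def)
  qed
  have tube: "\<exists>u. u 0 = (- h 0, - Pb) \<and> ode_on layer_field t u \<and> (\<forall>s\<in>{0..t}. norm (snd (u s)) \<le> q)"
    if t: "0 \<le> t" for t
  proof -
    define G :: "real \<Rightarrow> (real ^ 'n2 ^ 'n1) \<times> (real ^ 'n2 ^ 'n2) \<Rightarrow> real"
      where "G s u = max (norm (snd u) - q) (norm (fst u) - K')" for s u
    obtain u where u: "u 0 = (- h 0, - Pb)" "ode_on layer_field t u" "\<And>s. s \<in> {0..t} \<Longrightarrow> G s (u s) \<le> 0"
    proof (rule ode_exists_in_tube[OF lipschitz_on_balls_layer_field t])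
      show "continuous_on ({0..t} \<times> UNIV) (\<lambda>(s, x). G s x)"
        unfolding G_def case_prod_unfold by (intro continuous_intros)
      show "norm x \<le> K' + q" if "G s x \<le> 0" for s x
        using that norm_Pair_le[of "fst x" "snd x"] by (simp add: G_def)
      show "G 0 (- h 0, - Pb) \<le> 0" using Pb_less by (simp add: G_def K'_def)
      show "G s (u s) < 0" if s: "s \<in> {0..t}" and u: "u 0 = (- h 0, - Pb)" "ode_on layer_field s u"
        and le: "\<And>r. r \<in> {0..s} \<Longrightarrow> G r (u r) \<le> 0" for s u
      proof -
        have s0: "0 \<le> s" using s by simp
        have leq: "norm (snd (u r)) \<le> q" if "r \<in> {0..s}" for r using le[OF that] by (simp add: G_def)
        note d = decay[OF s0 u leq]
        have "p * exp (- w * s) \<le> p * 1" using p w s0 by (intro mult_left_mono) auto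
        moreover have "K * exp (- m * s) \<le> K * 1" using K m s0 by (intro mult_left_mono) auto
        ultimately show ?thesis using d(2,3) Pb_less by (simp add: G_def K'_def p_def)
      qed
    qed auto
    then have "norm (snd (u s)) \<le> q" if "s \<in> {0..t}" for s using u(3)[OF that] by (simp add: G_def)
    with u show ?thesis by blast
  qed
  then have "\<exists>u. u 0 = (- h 0, - Pb) \<and> ode_on layer_field t u" if "0 \<le> t" for t using that by blast
  then obtain u where u: "u 0 = (- h 0, - Pb)" "\<And>t. ode_on layer_field t u"
    using ode_global[OF lipschitz_on_balls_layer_field] by metis
  have uq: "norm (snd (u s)) \<le> q" if s: "0 \<le> s" for s
  proof -
    obtain v where v: "v 0 = (- h 0, - Pb)" "ode_on layer_field s v" "\<forall>r\<in>{0..s}. norm (snd (v r)) \<le> q"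
      using tube[OF s] by blast
    have "u s = v s"
      by (rule ode_unique[OF lipschitz_on_balls_layer_field u(2) v(2)]) (use u(1) v(1) s in simp_all)
    then show ?thesis using v(3) s by simp
  qed
  note d = decay[OF _ u(1) u(2) uq]
  have Zs: "snd (u s) \<in> Sym" and Zd: "norm (snd (u s)) \<le> p * exp (- w * s)"
    and Yd: "norm (fst (u s)) \<le> K * exp (- m * s)" if "0 \<le> s" for s
    using d[OF that] by auto
  show ?thesis
  proof
    show "boundary_layer_solution D Pb (\<lambda>s. fst (u s)) (\<lambda>s. snd (u s))"
      unfolding boundary_layer_solution_def
    proof (intro conjI allI impI)
      fix s :: real assume s: "0 \<le> s"
      have "(u has_vector_derivative layer_field (u s)) (at s within {0..s + 1})"
        using s by (intro ode_onD[OF u(2)]) auto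
      then have "(u has_vector_derivative layer_field (u s)) (at s within {0..})"
        using s by (rule has_vector_derivative_Icc_imp_Ici)
      from has_vector_derivative_fst[OF this] has_vector_derivative_snd[OF this]
      show "((\<lambda>s. fst (u s)) has_vector_derivative g1 D 0 (fst (u s) + h 0) (snd (u s) + Pb) 0) (at s within {0..})"
        and "((\<lambda>s. snd (u s)) has_vector_derivative g2 D 0 (fst (u s) + h 0) (snd (u s) + Pb) 0) (at s within {0..})"
        using Zs[OF s] by (simp_all add: layer_field_def sym_part_eq)
    qed (use u(1) Zs in auto)
    show "0 < m" by fact
    show "0 \<le> max K p" using K by simp
    fix s :: real assume s: "0 \<le> s"
    have "K * exp (- m * s) \<le> max K p * exp (- m * s)" by (intro mult_right_mono) auto
    then show "norm (fst (u s)) \<le> max K p * exp (- m * s)" using Yd[OF s] by linarith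
    have "p * exp (- w * s) \<le> max K p * exp (- m * s)"
      using m s K by (intro mult_mono) (auto intro: mult_right_mono)
    then show "norm (snd (u s)) \<le> max K p * exp (- m * s)" using Zd[OF s] by linarith
  qed
qed

end

section \<open>The error of the layer approximation\<close>

text \<open>
  The full system after the substitution \<open>s = T - t\<close>, which turns the terminal values into initial values.
\<close>

definition reversed_solution where
  "reversed_solution D e t x y z \<longleftrightarrow> x 0 = 0 \<and> y 0 = 0 \<and> z 0 = 0 \<and>
     (\<forall>s\<in>{0..t}.
        (x has_vector_derivative f D (x s) (y s) (z s) e) (at s within {0..t}) \<and>
        (y has_vector_derivative (1 / e) *\<^sub>R g1 D (x s) (y s) (z s) e) (at s within {0..t}) \<and>
        (z has_vector_derivative (1 / e) *\<^sub>R g2 D (x s) (y s) (z s) e) (at s within {0..t}))"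

context stable_layer
begin

definition h_slope where "h_slope = (A12 D + Delta D ** Pb) ** matrix_inv S"

lemma h_slope_mult_S: "h_slope ** S = A12 D + Delta D ** Pb"
  by (simp add: h_slope_def matrix_inv_mult[OF S_inv])

lemma h_affine: "h P = h 0 - P ** h_slope"
  by (simp add: hfun_def h_slope_def Smat_def[symmetric] matrix_mult_algebra)

text \<open>
  The defect of the approximation \<open>(X, h X + Y, Z + Pb)\<close> in the equation for the first fast variable: a term linear
  in the error, the effect of the errors in the other two variables, the interaction of the slow variable with
  the layer, and the terms of order \<open>e\<close>. No other terms remain because \<open>h X\<close> is the quasi-steady state.
\<close>

lemma g1_difference:
  "g1 D x y z e - g1 D 0 (Y + h 0) (Z + Pb) 0
    = (y - (h X + Y)) ** (S + Delta2 D ** Z) + (g1 D x y z 0 - g1 D X y (Z + Pb) 0)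
      + X ** (Delta D - h_slope ** Delta2 D) ** Z + e *\<^sub>R g1_remainder D x y"
proof -
  have affine: "g1 D X y (Z + Pb) 0 - g1 D 0 (Y + h 0) (Z + Pb) 0
      = (y - (Y + h 0)) ** (S + Delta2 D ** Z) + X ** (A12 D + Delta D ** Pb) + X ** Delta D ** Z"
    by (simp add: g1_def Smat_def matrix_mult_algebra)
  have "X ** h_slope ** S = X ** (A12 D + Delta D ** Pb)"
    by (simp flip: matrix_mul_assoc add: h_slope_mult_S)
  then show ?thesis
    using affine by (subst g1_eps) (simp add: h_affine[of X] matrix_mult_algebra algebra_simps)
qed

lemma g2_difference:
  "g2 D x y z e - g2 D x' y' (Z + Pb) 0
    = S\<^sup>\<top> ** (z - (Z + Pb)) + (z - (Z + Pb)) ** S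
      + Z ** Delta2 D ** (z - (Z + Pb)) + (z - (Z + Pb)) ** Delta2 D ** Z
      + (z - (Z + Pb)) ** Delta2 D ** (z - (Z + Pb)) + e *\<^sub>R g2_remainder D y z e"
proof -
  define w where "w = z - (Z + Pb)"
  have z: "z = (Z + w) + Pb" by (simp add: w_def)
  have "g2 D x' y' z 0 - g2 D x' y' (Z + Pb) 0
      = S\<^sup>\<top> ** w + w ** S + Z ** Delta2 D ** w + w ** Delta2 D ** Z + w ** Delta2 D ** w"
    unfolding z g2_layer by (simp add: matrix_mult_algebra)
  then show ?thesis
    unfolding g2_eps[of D x y z e x' y'] w_def by (simp add: algebra_simps)
qed

text \<open>
  The matrix \<open>S\<close> damps this error from both sides, at the total rate \<open>2 * \<gamma>\<close>. The quadratic term consumes at most half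
  of it as long as the error is small.
\<close>

lemma fast_energy_22:
  assumes "0 < e" "norm (z - (Z + Pb)) * norm (Delta2 D) \<le> \<gamma>" "norm Z \<le> k" "norm (g2_remainder D y z e) \<le> C"
  defines "w \<equiv> z - (Z + Pb)"
  shows "w \<bullet> (g2 D x y z e - g2 D x' y' (Z + Pb) 0)
    \<le> (- \<gamma> + 2 * norm (Delta2 D) * k) * (norm w)\<^sup>2 + e * C * norm w"
proof -
  define n where "n = norm w"
  define d where "d = norm (Delta2 D)"
  have n: "0 \<le> n" and d: "0 \<le> d" by (simp_all add: n_def d_def)
  have "w \<bullet> (g2 D x y z e - g2 D x' y' (Z + Pb) 0)
      = w \<bullet> (S\<^sup>\<top> ** w) + w \<bullet> (w ** S) + w \<bullet> (Z ** Delta2 D ** w) + w \<bullet> (w ** Delta2 D ** Z)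
        + w \<bullet> (w ** Delta2 D ** w) + w \<bullet> (e *\<^sub>R g2_remainder D y z e)"
    unfolding g2_difference w_def[symmetric] by (simp only: inner_add_right)
  also have "\<dots> \<le> - \<gamma> * n\<^sup>2 + - \<gamma> * n\<^sup>2 + n * (k * d * n) + n * (n * d * k) + n * (\<gamma> * n) + n * (e * C)"
  proof (intro add_mono)
    show "w \<bullet> (S\<^sup>\<top> ** w) \<le> - \<gamma> * n\<^sup>2" "w \<bullet> (w ** S) \<le> - \<gamma> * n\<^sup>2"
      unfolding n_def by (rule inner_mult_left_le[OF S_le] inner_mult_right_le[OF S_le])+
    show "w \<bullet> (Z ** Delta2 D ** w) \<le> n * (k * d * n)" unfolding n_def
    proof (rule inner_le_norms[OF order_trans[OF norm_mult3_le]])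
      show "norm Z * norm (Delta2 D) * norm w \<le> k * d * norm w"
        unfolding d_def using assms(3) by (intro mult_right_mono) auto
    qed
    show "w \<bullet> (w ** Delta2 D ** Z) \<le> n * (n * d * k)" unfolding n_def
    proof (rule inner_le_norms[OF order_trans[OF norm_mult3_le]])
      show "norm w * norm (Delta2 D) * norm Z \<le> norm w * d * k"
        unfolding d_def using assms(3) by (intro mult_left_mono) auto
    qed
    show "w \<bullet> (w ** Delta2 D ** w) \<le> n * (\<gamma> * n)" unfolding n_def
    proof (rule inner_le_norms[OF order_trans[OF norm_mult3_le]])
      show "norm w * norm (Delta2 D) * norm w \<le> \<gamma> * norm w"
        using assms(2) by (intro mult_right_mono) (auto simp: w_def)
    qed
    have "norm (e *\<^sub>R g2_remainder D y z e) \<le> e * C" using assms(1,4) by simp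
    then show "w \<bullet> (e *\<^sub>R g2_remainder D y z e) \<le> n * (e * C)" unfolding n_def by (rule inner_le_norms)
  qed
  also have "\<dots> = (- \<gamma> + 2 * d * k) * n\<^sup>2 + e * C * n"
    by (simp add: algebra_simps power2_eq_square)
  finally show ?thesis by (simp only: n_def d_def)
qed

text \<open>
  Here \<open>S\<close> acts from one side only, and all other terms of \<open>g1_difference\<close> count as forcing. The term \<open>d\<close> stands for
  the motion of the quasi-steady state.
\<close>

lemma fast_energy_12:
  fixes X :: "real ^ 'n1 ^ 'n1" and y Y :: "real ^ 'n2 ^ 'n1"
  assumes "norm Z \<le> k" "norm (g1 D x y z 0 - g1 D X y (Z + Pb) 0) \<le> a"
    "norm (X ** (Delta D - h_slope ** Delta2 D) ** Z) \<le> b" "norm (e *\<^sub>R g1_remainder D x y) \<le> c" "norm d \<le> d'"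
  defines "v \<equiv> y - (h X + Y)"
  shows "v \<bullet> (g1 D x y z e - g1 D 0 (Y + h 0) (Z + Pb) 0 + d)
    \<le> (- \<gamma> + norm (Delta2 D) * k) * (norm v)\<^sup>2 + norm v * (a + b + c + d')"
proof -
  have "v \<bullet> (g1 D x y z e - g1 D 0 (Y + h 0) (Z + Pb) 0 + d)
      = v \<bullet> (v ** S) + v \<bullet> (v ** Delta2 D ** Z) + v \<bullet> (g1 D x y z 0 - g1 D X y (Z + Pb) 0)
        + v \<bullet> (X ** (Delta D - h_slope ** Delta2 D) ** Z) + v \<bullet> (e *\<^sub>R g1_remainder D x y) + v \<bullet> d"
    unfolding g1_difference[of x y z e Y Z X] v_def[symmetric]
    by (simp add: matrix_mult_algebra(2,11) inner_add_right)
  also have "\<dots> \<le> - \<gamma> * (norm v)\<^sup>2 + norm v * (norm v * norm (Delta2 D) * k) + norm v * a + norm v * b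
      + norm v * c + norm v * d'"
  proof (intro add_mono)
    show "v \<bullet> (v ** S) \<le> - \<gamma> * (norm v)\<^sup>2" by (rule inner_mult_right_le[OF S_le])
    show "v \<bullet> (v ** Delta2 D ** Z) \<le> norm v * (norm v * norm (Delta2 D) * k)"
    proof (rule inner_le_norms[OF order_trans[OF norm_mult3_le]])
      show "norm v * norm (Delta2 D) * norm Z \<le> norm v * norm (Delta2 D) * k"
        using assms(1) by (intro mult_left_mono) auto
    qed
  qed (rule inner_le_norms assms)+
  also have "\<dots> = (- \<gamma> + norm (Delta2 D) * k) * (norm v)\<^sup>2 + norm v * (a + b + c + d')"
    by (simp add: algebra_simps power2_eq_square)
  finally show ?thesis .
qed

text \<open>
  Any solution of the full system that stays in a tube of fixed radius around the approximation is in fact within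
  \<open>O(e)\<close> of it. The second fast variable is handled by \<open>layer_energy\<close>, the pair of the slow and the first
  fast variable by \<open>slow_fast_energy\<close>.
\<close>

lemma layer_error_estimate:
  assumes X: "\<And>s. s \<in> {0..T} \<Longrightarrow> (X has_vector_derivative f D (X s) (h (X s)) 0 0) (at s within {0..T})"
    and X0: "X 0 = 0" and T: "0 \<le> T"
    and YZ: "boundary_layer_solution D Pb Y Z" and m: "0 < m" and K: "0 \<le> K"
    and Y_le: "\<And>s. 0 \<le> s \<Longrightarrow> norm (Y s) \<le> K * exp (- m * s)"
    and Z_le: "\<And>s. 0 \<le> s \<Longrightarrow> norm (Z s) \<le> K * exp (- m * s)"
  shows "\<exists>r>0. \<exists>M\<ge>0. \<forall>e t x y z. 0 < e \<longrightarrow> e \<le> 1 \<longrightarrow> t \<in> {0..T} \<longrightarrow> reversed_solution D e t x y z \<longrightarrow>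
      (\<forall>s\<in>{0..t}. norm (x s - X s) \<le> r \<and> norm (y s - (h (X s) + Y (s / e))) \<le> r
        \<and> norm (z s - (Z (s / e) + Pb)) \<le> r) \<longrightarrow>
      norm (x t - X t) \<le> M * e \<and> norm (y t - (h (X t) + Y (t / e))) \<le> M * e
        \<and> norm (z t - (Z (t / e) + Pb)) \<le> M * e"
proof -
  have "continuous_on {0..T} X"
    unfolding continuous_on_eq_continuous_within using X has_vector_derivative_continuous by blast
  then have "compact (X ` {0..T})" by (intro compact_continuous_image) auto
  then obtain A where "\<forall>x\<in>X ` {0..T}. norm x \<le> A" using compact_imp_bounded bounded_iff by metis
  then have A: "norm (X s) \<le> A" if "s \<in> {0..T}" for s using that by auto
  have A0: "0 \<le> A" using A[of 0] X0 T by simp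
  \<comment> \<open>\<open>R\<close> bounds every component of the approximation and of a solution at distance
    at most 1 from it.\<close>
  define R where "R = A + (norm (h 0) + A * norm h_slope) + K + norm Pb + 1"
  have hX: "norm (h (X s)) \<le> norm (h 0) + A * norm h_slope" if s: "s \<in> {0..T}" for s
  proof -
    have "norm (h (X s)) \<le> norm (h 0) + norm (X s ** h_slope)"
      unfolding h_affine[of "X s"] by (rule norm_triangle_ineq4)
    also have "norm (X s ** h_slope) \<le> A * norm h_slope"
      using norm_matrix_mult_le[of "X s" h_slope] mult_right_mono[OF A[OF s], of "norm h_slope"] by simp
    finally show ?thesis by simp
  qed
  have R0: "0 \<le> A * norm h_slope" using A0 by simp
  have exp_le: "K * exp (- m * (s / e)) \<le> K" if "0 \<le> s" "0 < e" for s e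
    using mult_left_mono[of "exp (- m * (s / e))" 1 K] that m K by simp
  have f_lip: "lipschitz_on_balls (\<lambda>u. f D (fst u) (snd u) 0 0)"
    by (intro lipschitz_on_balls_f lipschitz_on_balls_intros)
  have g1_lip: "lipschitz_on_balls (\<lambda>u. g1 D (fst u) (fst (snd u)) (snd (snd u)) 0)"
    by (intro lipschitz_on_balls_g1 lipschitz_on_balls_intros)
  have r1_lip: "lipschitz_on_balls (\<lambda>u. g1_remainder D (fst u) (snd u))"
    unfolding g1_remainder_def by (intro lipschitz_on_balls_intros)
  have r2_lip: "lipschitz_on_balls (\<lambda>u. g2_remainder D (fst u) (fst (snd u)) (snd (snd u)))"
    unfolding g2_remainder_def by (intro lipschitz_on_balls_intros)
  obtain L1 where L1: "0 < L1" "\<And>u v. norm u \<le> 2 * R \<Longrightarrow> norm v \<le> 2 * R \<Longrightarrow>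
      norm (f D (fst u) (snd u) 0 0 - f D (fst v) (snd v) 0 0) \<le> L1 * norm (u - v)"
    using lipschitz_on_ballsE[OF f_lip, of "2 * R"] by blast
  obtain L2 where L2: "0 < L2" "\<And>u v. norm u \<le> 3 * R \<Longrightarrow> norm v \<le> 3 * R \<Longrightarrow>
      norm (g1 D (fst u) (fst (snd u)) (snd (snd u)) 0 - g1 D (fst v) (fst (snd v)) (snd (snd v)) 0) \<le> L2 * norm (u - v)"
    using lipschitz_on_ballsE[OF g1_lip, of "3 * R"] by blast
  obtain A' where A': "0 < A'" "\<And>u. norm u \<le> 2 * R \<Longrightarrow> norm (f D (fst u) (snd u) 0 0) \<le> A'"
    using lipschitz_on_balls_bounded[OF f_lip, of "2 * R"] by blast
  obtain C1 where C1: "0 < C1" "\<And>u. norm u \<le> 2 * R \<Longrightarrow> norm (g1_remainder D (fst u) (snd u)) \<le> C1"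
    using lipschitz_on_balls_bounded[OF r1_lip, of "2 * R"] by blast
  obtain C2 where C2: "0 < C2" "\<And>u. norm u \<le> 2 * R + 1 \<Longrightarrow> norm (g2_remainder D (fst u) (fst (snd u)) (snd (snd u))) \<le> C2"
    using lipschitz_on_balls_bounded[OF r2_lip, of "2 * R + 1"] by blast
  have X'_le: "norm (f D (X s) (h (X s)) 0 0) \<le> A'" if s: "s \<in> {0..T}" for s
  proof -
    have "norm (X s, h (X s)) \<le> 2 * R"
      using norm_Pair_le[of "X s" "h (X s)"] A[OF s] hX[OF s] R0 A0 K norm_ge_zero[of "h 0"] norm_ge_zero[of Pb]
      unfolding R_def by argo
    then show ?thesis using A'(2)[of "(X s, h (X s))"] by simp
  qed
  have X_growth: "norm (X s) \<le> A' * s" if "s \<in> {0..T}" for s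
    by (rule norm_le_linear_growth[OF X X'_le X0 that])
  define d where "d = norm (Delta2 D)"
  \<comment> \<open>\<open>C3 * e\<close> bounds the product of \<open>X s = O(s)\<close> with the layer, since
    \<open>s * exp (- m * s / e) \<le> e / m\<close>.\<close>
  define C3 where "C3 = A' * norm (Delta D - h_slope ** Delta2 D) * K / m"
  define M2 where "M2 = exp (2 * d * K / m) * C2 / \<gamma>"
  define b where "b = L2 * (1 + M2) + C3 + C1 + A' * norm h_slope"
  define M where "M = exp ((2 * L1 + 2 * L1\<^sup>2 / \<gamma> + 2 * b\<^sup>2 / \<gamma>) * T + (2 * (d * K) + 1) / m)
                * (L1\<^sup>2 * K\<^sup>2 / m + 2 * b\<^sup>2 / \<gamma> * T)"
  define M1 where "M1 = exp (d * K / m) * b * (1 + sqrt M) / \<gamma>"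
  \<comment> \<open>The tube is so thin that the quadratic term of the \<open>\<zeta>\<close> equation costs at
    most \<open>\<gamma>\<close>, half of the available damping.\<close>
  define r where "r = min 1 (\<gamma> / (d + 1))"
  have d: "0 \<le> d" by (simp add: d_def)
  have r: "0 < r" "r \<le> 1" using \<gamma> d by (auto simp: r_def add_nonneg_pos)
  have rd: "r * d \<le> \<gamma>"
  proof -
    have "r * d \<le> \<gamma> / (d + 1) * d" using d by (intro mult_right_mono) (auto simp: r_def)
    also have "\<dots> \<le> \<gamma>" using d \<gamma> by (simp add: field_simps)
    finally show ?thesis .
  qed
  have M2: "0 \<le> M2" using C2 \<gamma> by (simp add: M2_def)
  have C3: "0 \<le> C3" using A' K m by (simp add: C3_def)
  have b: "0 \<le> b" using L2(1) M2 C3 C1(1) A'(1) by (simp add: b_def)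
  show ?thesis
  proof (rule exI[of _ r], intro conjI \<open>0 < r\<close>, rule exI[of _ "max (max (sqrt M) M1) M2"], rule conjI)
    show "0 \<le> max (max (sqrt M) M1) M2" using M2 by simp
    show "\<forall>e t x y z. 0 < e \<longrightarrow> e \<le> 1 \<longrightarrow> t \<in> {0..T} \<longrightarrow> reversed_solution D e t x y z \<longrightarrow>
      (\<forall>s\<in>{0..t}. norm (x s - X s) \<le> r \<and> norm (y s - (h (X s) + Y (s / e))) \<le> r
        \<and> norm (z s - (Z (s / e) + Pb)) \<le> r) \<longrightarrow>
      norm (x t - X t) \<le> max (max (sqrt M) M1) M2 * e
        \<and> norm (y t - (h (X t) + Y (t / e))) \<le> max (max (sqrt M) M1) M2 * e
        \<and> norm (z t - (Z (t / e) + Pb)) \<le> max (max (sqrt M) M1) M2 * e"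
    proof (intro allI impI)
      fix e t x y z
      assume e: "0 < e" "e \<le> 1" and t: "t \<in> {0..T}" and sol: "reversed_solution D e t x y z"
        and tube: "\<forall>s\<in>{0..t}. norm (x s - X s) \<le> r \<and> norm (y s - (h (X s) + Y (s / e))) \<le> r
          \<and> norm (z s - (Z (s / e) + Pb)) \<le> r"
      have x0: "x 0 = 0" and y0: "y 0 = 0" and z0: "z 0 = 0"
        using sol by (simp_all add: reversed_solution_def)
      have x: "(x has_vector_derivative f D (x s) (y s) (z s) e) (at s within {0..t})"
        and y: "(y has_vector_derivative (1 / e) *\<^sub>R g1 D (x s) (y s) (z s) e) (at s within {0..t})"
        and z: "(z has_vector_derivative (1 / e) *\<^sub>R g2 D (x s) (y s) (z s) e) (at s within {0..t})"
        if "s \<in> {0..t}" for s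
        using sol that unfolding reversed_solution_def by blast+
      have xr: "norm (x s - X s) \<le> r" and yr: "norm (y s - (h (X s) + Y (s / e))) \<le> r"
        and zr: "norm (z s - (Z (s / e) + Pb)) \<le> r" if "s \<in> {0..t}" for s
        using tube that by blast+
      define \<xi> where "\<xi> s = x s - X s" for s
      define \<eta> where "\<eta> s = y s - (h (X s) + Y (s / e))" for s
      define \<zeta> where "\<zeta> s = z s - (Z (s / e) + Pb)" for s
      define \<xi>' where "\<xi>' s = f D (x s) (y s) (z s) e - f D (X s) (h (X s)) 0 0" for s
      define \<eta>' where "\<eta>' s = (1 / e) *\<^sub>R (g1 D (x s) (y s) (z s) e - g1 D 0 (Y (s / e) + h 0) (Z (s / e) + Pb) 0
          + e *\<^sub>R (f D (X s) (h (X s)) 0 0 ** h_slope))" for s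
      define \<zeta>' where "\<zeta>' s = (1 / e) *\<^sub>R (g2 D (x s) (y s) (z s) e - g2 D 0 (Y (s / e) + h 0) (Z (s / e) + Pb) 0)" for s
      have Xt: "(X has_vector_derivative f D (X s) (h (X s)) 0 0) (at s within {0..t})" if "s \<in> {0..t}" for s
        using that t by (intro has_vector_derivative_within_subset[OF X]) auto
      have Ye: "((\<lambda>s. Y (s / e)) has_vector_derivative (1 / e) *\<^sub>R g1 D 0 (Y (s / e) + h 0) (Z (s / e) + Pb) 0) (at s within {0..t})"
        and Ze: "((\<lambda>s. Z (s / e)) has_vector_derivative (1 / e) *\<^sub>R g2 D 0 (Y (s / e) + h 0) (Z (s / e) + Pb) 0) (at s within {0..t})"
        if "s \<in> {0..t}" for s
        using YZ by (intro layer_time_derivative[OF _ \<open>0 < e\<close> that]; simp add: boundary_layer_solution_def)+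
      have \<xi>: "(\<xi> has_vector_derivative \<xi>' s) (at s within {0..t})" if "s \<in> {0..t}" for s
        unfolding \<xi>_def \<xi>'_def by (intro has_vector_derivative_diff x[OF that] Xt[OF that])
      have \<eta>: "(\<eta> has_vector_derivative \<eta>' s) (at s within {0..t})" if s: "s \<in> {0..t}" for s
      proof -
        have "((\<lambda>s. X s ** h_slope) has_vector_derivative f D (X s) (h (X s)) 0 0 ** h_slope) (at s within {0..t})"
          by (rule bounded_linear.has_vector_derivative[OF
              bounded_bilinear.bounded_linear_left[OF bounded_bilinear_matrix_mult] Xt[OF s]])
        then have "((\<lambda>s. y s - ((h 0 - X s ** h_slope) + Y (s / e))) has_vector_derivative
            (1 / e) *\<^sub>R g1 D (x s) (y s) (z s) e - ((0 - f D (X s) (h (X s)) 0 0 ** h_slope)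
              + (1 / e) *\<^sub>R g1 D 0 (Y (s / e) + h 0) (Z (s / e) + Pb) 0)) (at s within {0..t})"
          by (intro derivative_intros y[OF s] Ye[OF s])
        then show ?thesis
          unfolding \<eta>_def \<eta>'_def h_affine[of "X _"] using \<open>0 < e\<close>
          by (simp add: scaleR_add_right scaleR_diff_right algebra_simps)
      qed
      have \<zeta>: "(\<zeta> has_vector_derivative \<zeta>' s) (at s within {0..t})" if s: "s \<in> {0..t}" for s
      proof -
        have "((\<lambda>s. z s - (Z (s / e) + Pb)) has_vector_derivative
            (1 / e) *\<^sub>R g2 D (x s) (y s) (z s) e
              - ((1 / e) *\<^sub>R g2 D 0 (Y (s / e) + h 0) (Z (s / e) + Pb) 0 + 0)) (at s within {0..t})"
          by (intro derivative_intros z[OF s] Ze[OF s])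
        then show ?thesis
          unfolding \<zeta>_def \<zeta>'_def by (simp add: scaleR_diff_right)
      qed
      have zero: "\<xi> 0 = 0" "\<eta> 0 = 0" "\<zeta> 0 = 0"
        using YZ by (simp_all add: \<xi>_def \<eta>_def \<zeta>_def x0 y0 z0 X0 boundary_layer_solution_def)
      have small: "norm (\<xi> s) \<le> r" "norm (\<eta> s) \<le> r" "norm (\<zeta> s) \<le> r" if "s \<in> {0..t}" for s
        using xr[OF that] yr[OF that] zr[OF that] by (simp_all add: \<xi>_def \<eta>_def \<zeta>_def)
      have sT: "s \<in> {0..T}" if "s \<in> {0..t}" for s using that t by simp
      have layer_le: "norm (Y (s / e)) \<le> K * exp (- m * s / e)" "norm (Z (s / e)) \<le> K * exp (- m * s / e)"
        "norm (Y (s / e)) \<le> K" "norm (Z (s / e)) \<le> K" if "s \<in> {0..t}" for s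
        using Y_le[of "s / e"] Z_le[of "s / e"] exp_le[of s e] that e by auto
      have bd: "norm (x s) \<le> R" "norm (y s) \<le> R" "norm (z s) \<le> R" "norm (X s) \<le> R" "norm (h (X s)) \<le> R"
        "norm (Z (s / e) + Pb) \<le> R" if s: "s \<in> {0..t}" for s
      proof -
        note l = layer_le(3,4)[OF s] A[OF sT[OF s]] hX[OF sT[OF s]] xr[OF s] yr[OF s] zr[OF s]
        show "norm (x s) \<le> R" using norm_triangle_sub[of "x s" "X s"] l r R0 K
          unfolding R_def by (smt (verit) norm_ge_zero)
        show "norm (y s) \<le> R"
          using norm_triangle_sub[of "y s" "h (X s) + Y (s / e)"] norm_triangle_ineq[of "h (X s)" "Y (s / e)"] l r R0 K A0
          unfolding R_def by (smt (verit) norm_ge_zero)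
        show ZP: "norm (Z (s / e) + Pb) \<le> R" using norm_triangle_ineq[of "Z (s / e)" Pb] l R0 A0
          unfolding R_def by (smt (verit) norm_ge_zero)
        show "norm (z s) \<le> R"
          using norm_triangle_sub[of "z s" "Z (s / e) + Pb"] norm_triangle_ineq[of "Z (s / e)" Pb] l r R0 A0
          unfolding R_def by (smt (verit) norm_ge_zero)
        show "norm (X s) \<le> R" "norm (h (X s)) \<le> R" using l R0 K A0
          unfolding R_def by (smt (verit) norm_ge_zero)+
      qed
      \<comment> \<open>The error of the second fast variable is estimated first: the other two enter its
        equation only at order \<open>e\<close>.\<close>
      have \<zeta>_le: "norm (\<zeta> s) \<le> M2 * e" if s: "s \<in> {0..t}" for s
      proof -
        have "norm (\<zeta> s) \<le> exp (2 * d * K / m) * (e * C2) / \<gamma>"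
        proof (rule layer_energy[where E' = \<zeta>' and e = e])
          fix q assume "q \<in> {0..s}"
          then have q: "q \<in> {0..t}" "{0..s} \<subseteq> {0..t}" using s by auto
          show "(\<zeta> has_vector_derivative \<zeta>' q) (at q within {0..s})"
            by (rule has_vector_derivative_within_subset[OF \<zeta>[OF q(1)] q(2)])
          have "e * (\<zeta> q \<bullet> \<zeta>' q) = \<zeta> q \<bullet> (g2 D (x q) (y q) (z q) e - g2 D 0 (Y (q / e) + h 0) (Z (q / e) + Pb) 0)"
            using \<open>0 < e\<close> by (simp add: \<zeta>'_def)
          also have "\<dots> \<le> (- \<gamma> + 2 * norm (Delta2 D) * (K * exp (- m * q / e))) * (norm (\<zeta> q))\<^sup>2 + e * C2 * norm (\<zeta> q)"
            unfolding \<zeta>_def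
          proof (rule fast_energy_22[OF \<open>0 < e\<close> _ layer_le(2)[OF q(1)]])
            have "norm (z q - (Z (q / e) + Pb)) * norm (Delta2 D) \<le> r * d"
              using zr[OF q(1)] unfolding d_def by (intro mult_right_mono) auto
            then show "norm (z q - (Z (q / e) + Pb)) * norm (Delta2 D) \<le> \<gamma>" using rd by simp
            have "norm (y q, z q, e) \<le> 2 * R + 1"
              using norm_Pair_le[of "y q" "(z q, e)"] norm_Pair_le[of "z q" e] bd(2,3)[OF q(1)] e by simp
            then show "norm (g2_remainder D (y q) (z q) e) \<le> C2" using C2(2)[of "(y q, z q, e)"] by simp
          qed
          finally show "e * (\<zeta> q \<bullet> \<zeta>' q) \<le> (- \<gamma> + 2 * d * K * exp (- m * q / e)) * (norm (\<zeta> q))\<^sup>2 + e * C2 * norm (\<zeta> q)"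
            by (simp add: d_def mult.assoc)
        qed (use s e \<gamma> C2(1) d K m zero in auto)
        then show ?thesis by (simp add: M2_def ac_simps)
      qed
      have \<xi>_energy: "\<xi> s \<bullet> \<xi>' s \<le> L1 * norm (\<xi> s) * (norm (\<xi> s) + norm (\<eta> s) + K * exp (- m * s / e))"
        if s: "s \<in> {0..t}" for s
      proof -
        have "\<xi>' s = f D (x s) (y s) 0 0 - f D (X s) (h (X s)) 0 0"
          unfolding \<xi>'_def by (simp only: f_only_depends_on_P11_P12[of D "x s" "y s" "z s" e 0 0])
        then have "norm (\<xi>' s) \<le> L1 * norm ((x s, y s) - (X s, h (X s)))"
          using L1(2)[of "(x s, y s)" "(X s, h (X s))"] norm_Pair_le[of "x s" "y s"] norm_Pair_le[of "X s" "h (X s)"] bd[OF s]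
          by simp
        also have "norm ((x s, y s) - (X s, h (X s))) \<le> norm (\<xi> s) + norm (\<eta> s + Y (s / e))"
          using norm_Pair_le[of "x s - X s" "y s - h (X s)"] by (simp add: \<xi>_def \<eta>_def)
        also have "norm (\<eta> s + Y (s / e)) \<le> norm (\<eta> s) + K * exp (- m * s / e)"
          using norm_triangle_ineq[of "\<eta> s" "Y (s / e)"] layer_le(1)[OF s] by linarith
        finally have "norm (\<xi>' s) \<le> L1 * (norm (\<xi> s) + norm (\<eta> s) + K * exp (- m * s / e))"
          using L1(1) by (simp add: add.assoc)
        then have "\<xi> s \<bullet> \<xi>' s \<le> norm (\<xi> s) * (L1 * (norm (\<xi> s) + norm (\<eta> s) + K * exp (- m * s / e)))"
          by (rule inner_le_norms)
        then show ?thesis by (simp only: mult.assoc mult.left_commute[of "norm (\<xi> s)" L1])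
      qed
      have \<eta>_energy: "e * (\<eta> s \<bullet> \<eta>' s)
          \<le> (- \<gamma> + d * K * exp (- m * s / e)) * (norm (\<eta> s))\<^sup>2 + b * norm (\<eta> s) * (e + norm (\<xi> s))"
        if s: "s \<in> {0..t}" for s
      proof -
        have "e * (\<eta> s \<bullet> \<eta>' s) = \<eta> s \<bullet> (g1 D (x s) (y s) (z s) e - g1 D 0 (Y (s / e) + h 0) (Z (s / e) + Pb) 0
            + e *\<^sub>R (f D (X s) (h (X s)) 0 0 ** h_slope))"
          using \<open>0 < e\<close> by (simp add: \<eta>'_def)
        also have "\<dots> \<le> (- \<gamma> + norm (Delta2 D) * (K * exp (- m * s / e))) * (norm (\<eta> s))\<^sup>2
            + norm (\<eta> s) * (L2 * (norm (\<xi> s) + M2 * e) + C3 * e + C1 * e + A' * norm h_slope * e)"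
          unfolding \<eta>_def
        proof (rule fast_energy_12[OF layer_le(2)[OF s]])
          have "norm ((x s, y s, z s) - (X s, y s, Z (s / e) + Pb)) \<le> norm (\<xi> s) + norm (\<zeta> s)"
            using norm_Pair_le[of "\<xi> s" "(0 :: real ^ 'n2 ^ 'n1, \<zeta> s)"] norm_Pair_le[of "0 :: real ^ 'n2 ^ 'n1" "\<zeta> s"]
            by (simp add: \<xi>_def \<zeta>_def)
          moreover have "norm (g1 D (x s) (y s) (z s) 0 - g1 D (X s) (y s) (Z (s / e) + Pb) 0)
              \<le> L2 * norm ((x s, y s, z s) - (X s, y s, Z (s / e) + Pb))"
            using L2(2)[of "(x s, y s, z s)" "(X s, y s, Z (s / e) + Pb)"] bd[OF s]
              norm_Pair_le[of "x s" "(y s, z s)"] norm_Pair_le[of "y s" "z s"]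
              norm_Pair_le[of "X s" "(y s, Z (s / e) + Pb)"] norm_Pair_le[of "y s" "Z (s / e) + Pb"]
            by simp
          ultimately show "norm (g1 D (x s) (y s) (z s) 0 - g1 D (X s) (y s) (Z (s / e) + Pb) 0)
              \<le> L2 * (norm (\<xi> s) + M2 * e)"
            using \<zeta>_le[OF s] L2(1) by (smt (verit) mult_left_mono)
          have "norm (X s ** (Delta D - h_slope ** Delta2 D) ** Z (s / e))
              \<le> norm (X s) * norm (Delta D - h_slope ** Delta2 D) * norm (Z (s / e))"
            by (rule norm_mult3_le)
          also have "\<dots> \<le> (A' * s) * norm (Delta D - h_slope ** Delta2 D) * (K * exp (- m * s / e))"
            using X_growth[OF sT[OF s]] layer_le(2)[OF s] A'(1) s by (intro mult_mono) auto
          also have "\<dots> = C3 * (m * s * exp (- m * s / e))"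
            using m by (simp add: C3_def)
          also have "\<dots> \<le> C3 * e"
          proof (intro mult_left_mono C3)
            have "m * s / e \<le> exp (m * s / e)" using exp_ge_add_one_self[of "m * s / e"] by linarith
            then have "m * s \<le> e * exp (m * s / e)" using \<open>0 < e\<close> by (simp add: field_simps)
            then have "m * s * exp (- (m * s / e)) \<le> e * exp (m * s / e) * exp (- (m * s / e))"
              by (intro mult_right_mono) auto
            then show "m * s * exp (- m * s / e) \<le> e" by (simp add: mult.assoc flip: exp_add)
          qed
          finally show "norm (X s ** (Delta D - h_slope ** Delta2 D) ** Z (s / e)) \<le> C3 * e" .
          show "norm (e *\<^sub>R g1_remainder D (x s) (y s)) \<le> C1 * e"
            using C1(2)[of "(x s, y s)"] norm_Pair_le[of "x s" "y s"] bd[OF s] \<open>0 < e\<close> by (simp add: mult.commute)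
          have "norm (f D (X s) (h (X s)) 0 0 ** h_slope) \<le> A' * norm h_slope"
            using norm_matrix_mult_le[of "f D (X s) (h (X s)) 0 0" h_slope]
              mult_right_mono[OF X'_le[OF sT[OF s]], of "norm h_slope"] by simp
          then show "norm (e *\<^sub>R (f D (X s) (h (X s)) 0 0 ** h_slope)) \<le> A' * norm h_slope * e"
            using \<open>0 < e\<close> by (simp add: mult.commute)
        qed
        also have "norm (\<eta> s) * (L2 * (norm (\<xi> s) + M2 * e) + C3 * e + C1 * e + A' * norm h_slope * e)
            \<le> norm (\<eta> s) * (b * (e + norm (\<xi> s)))"
        proof (intro mult_left_mono)
          have "L2 * norm (\<xi> s) \<le> b * norm (\<xi> s)"
            using L2(1) M2 C3 C1(1) A'(1) by (intro mult_right_mono) (simp_all add: b_def distrib_left)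
          moreover have "L2 * (M2 * e) + C3 * e + C1 * e + A' * norm h_slope * e \<le> b * e"
            using L2(1) \<open>0 < e\<close> by (simp add: b_def algebra_simps)
          ultimately show "L2 * (norm (\<xi> s) + M2 * e) + C3 * e + C1 * e + A' * norm h_slope * e \<le> b * (e + norm (\<xi> s))"
            by (simp add: distrib_left)
        qed simp
        finally show ?thesis by (simp add: d_def ac_simps)
      qed
      note sf = slow_fast_energy[where L = L1 and a = \<gamma> and b = b and C = "d * K" and m = m and T = T and k = K
          and e = e and t = t and X = \<xi> and X' = \<xi>' and Y = \<eta> and Y' = \<eta>', folded M_def]
      have "norm (\<xi> t) \<le> sqrt M * e" "norm (\<eta> t) \<le> M1 * e"
        unfolding M1_def
        by (rule sf; use t e \<gamma> b d K m L1(1) \<xi> \<eta> zero \<xi>_energy \<eta>_energy in \<open>simp only: atLeastAtMost_iff less_imp_le mult_nonneg_nonneg\<close>)+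
      moreover have "norm (\<zeta> t) \<le> M2 * e" using \<zeta>_le[of t] t by simp
      moreover have "sqrt M * e \<le> max (max (sqrt M) M1) M2 * e" "M1 * e \<le> max (max (sqrt M) M1) M2 * e"
        "M2 * e \<le> max (max (sqrt M) M1) M2 * e"
        using \<open>0 < e\<close> by (intro mult_right_mono; simp)+
      ultimately have "norm (\<xi> t) \<le> max (max (sqrt M) M1) M2 * e" "norm (\<eta> t) \<le> max (max (sqrt M) M1) M2 * e"
        "norm (\<zeta> t) \<le> max (max (sqrt M) M1) M2 * e" by linarith+
      then show "norm (x t - X t) \<le> max (max (sqrt M) M1) M2 * e
          \<and> norm (y t - (h (X t) + Y (t / e))) \<le> max (max (sqrt M) M1) M2 * e
          \<and> norm (z t - (Z (t / e) + Pb)) \<le> max (max (sqrt M) M1) M2 * e"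
        by (simp add: \<xi>_def \<eta>_def \<zeta>_def)
    qed
  qed
qed

end

section \<open>The time-reversed full system\<close>

text \<open>
  The vector field of the time-reversed full system on triples. As for the boundary layer, the square components
  are symmetrised, so that solutions starting from zero have symmetric square components.
\<close>

definition full_field :: "('n1::finite, 'n2::finite, 'k1::finite, 'k2::finite) riccati_data \<Rightarrow> real \<Rightarrow>
    (real ^ 'n1 ^ 'n1) \<times> (real ^ 'n2 ^ 'n1) \<times> (real ^ 'n2 ^ 'n2) \<Rightarrow> (real ^ 'n1 ^ 'n1) \<times> (real ^ 'n2 ^ 'n1) \<times> (real ^ 'n2 ^ 'n2)" where
  "full_field D e u = (f D (sym_part (fst u)) (fst (snd u)) (sym_part (snd (snd u))) e,
     (1 / e) *\<^sub>R g1 D (sym_part (fst u)) (fst (snd u)) (sym_part (snd (snd u))) e,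
     (1 / e) *\<^sub>R g2 D (sym_part (fst u)) (fst (snd u)) (sym_part (snd (snd u))) e)"

lemma lipschitz_on_balls_full_field: "lipschitz_on_balls (full_field D e)"
  unfolding full_field_def by (intro lipschitz_on_balls_intros lipschitz_on_balls_f lipschitz_on_balls_g1 lipschitz_on_balls_g2)

lemma full_solution_imp_ode:
  assumes "full_solution D T e P11 P12 P22" "0 < e"
  shows "ode_on (full_field D e) T (\<lambda>s. (P11 (T - s), P12 (T - s), P22 (T - s)))"
  unfolding ode_on_def
proof
  fix s assume s: "s \<in> {0..T}"
  then have t: "T - s \<in> {0..T}" by simp
  then have sym: "P11 (T - s) \<in> Sym" "P22 (T - s) \<in> Sym"
    using assms unfolding full_solution_def by blast+
  obtain P11' P12' P22' where
    der: "(P11 has_vector_derivative P11') (at (T - s) within {0..T})"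
      "(P12 has_vector_derivative P12') (at (T - s) within {0..T})"
      "(P22 has_vector_derivative P22') (at (T - s) within {0..T})"
    and eq: "P11' + f D (P11 (T - s)) (P12 (T - s)) (P22 (T - s)) e = 0"
      "e *\<^sub>R P12' + g1 D (P11 (T - s)) (P12 (T - s)) (P22 (T - s)) e = 0"
      "e *\<^sub>R P22' + g2 D (P11 (T - s)) (P12 (T - s)) (P22 (T - s)) e = 0"
    using assms t unfolding full_solution_def by blast
  have scale: "(1 / e) *\<^sub>R g = - p" if "e *\<^sub>R p + g = 0" for g p :: "real ^ 'x::finite ^ 'y::finite"
  proof -
    have "g = - (e *\<^sub>R p)" using that by (simp add: eq_neg_iff_add_eq_0 add.commute)
    then show ?thesis using \<open>0 < e\<close> by simp
  qed
  have "((\<lambda>s. (P11 (T - s), P12 (T - s), P22 (T - s))) has_vector_derivative (- P11', - P12', - P22')) (at s within {0..T})"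
    by (intro has_vector_derivative_Pair reverse_time_derivative der s)
  moreover have "full_field D e (P11 (T - s), P12 (T - s), P22 (T - s)) = (- P11', - P12', - P22')"
    using eq(1) scale[OF eq(2)] scale[OF eq(3)]
    by (simp add: full_field_def sym_part_eq sym eq_neg_iff_add_eq_0 add.commute)
  ultimately show "((\<lambda>s. (P11 (T - s), P12 (T - s), P22 (T - s))) has_vector_derivative
      full_field D e (P11 (T - s), P12 (T - s), P22 (T - s))) (at s within {0..T})" by simp
qed

lemma full_solution_unique:
  assumes "full_solution D T e P11 P12 P22" "full_solution D T e R11 R12 R22" "0 < e" "t \<in> {0..T}"
  shows "R11 t = P11 t \<and> R12 t = P12 t \<and> R22 t = P22 t"
proof -
  have "(R11 (T - (T - t)), R12 (T - (T - t)), R22 (T - (T - t)))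
      = (P11 (T - (T - t)), P12 (T - (T - t)), P22 (T - (T - t)))"
    by (rule ode_unique[OF lipschitz_on_balls_full_field full_solution_imp_ode[OF assms(2,3)] full_solution_imp_ode[OF assms(1,3)]])
       (use assms in \<open>simp_all add: full_solution_def\<close>)
  then show ?thesis by simp
qed

lemma full_field_symmetric:
  assumes "Q1 D \<in> Sym" "Q2 D \<in> Sym" "ode_on (full_field D e) T u" "u 0 = 0" "s \<in> {0..T}"
  shows "fst (u s) \<in> Sym" "snd (snd (u s)) \<in> Sym"
proof -
  note u = ode_onD[OF assms(3)]
  have 0: "0 \<in> Sym" by (simp add: Sym_def transpose_algebra)
  show "fst (u s) \<in> Sym"
    by (rule Sym_preserved[OF has_vector_derivative_fst[OF u] _ _ assms(5)])
       (simp_all add: full_field_def f_in_Sym[OF assms(1)] sym_part_in_Sym assms(4) 0)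
  have scale: "c *\<^sub>R M \<in> Sym" if "M \<in> Sym" for c and M :: "real ^ 'b ^ 'b"
    using that by (simp add: Sym_def transpose_algebra)
  show "snd (snd (u s)) \<in> Sym"
    by (rule Sym_preserved[OF has_vector_derivative_snd[OF has_vector_derivative_snd[OF u]] _ _ assms(5)])
       (simp_all add: full_field_def scale g2_in_Sym[OF assms(2)] sym_part_in_Sym assms(4) 0)
qed

lemma reversed_solution_if_ode:
  assumes "Q1 D \<in> Sym" "Q2 D \<in> Sym" "ode_on (full_field D e) T u" "u 0 = 0"
  shows "reversed_solution D e T (\<lambda>s. fst (u s)) (\<lambda>s. fst (snd (u s))) (\<lambda>s. snd (snd (u s)))"
  unfolding reversed_solution_def
proof (intro conjI ballI)
  fix s assume s: "s \<in> {0..T}"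
  note u = ode_onD[OF assms(3) s]
  note sym = full_field_symmetric[OF assms s]
  show "((\<lambda>s. fst (u s)) has_vector_derivative f D (fst (u s)) (fst (snd (u s))) (snd (snd (u s))) e) (at s within {0..T})"
    using has_vector_derivative_fst[OF u] by (simp add: full_field_def sym_part_eq sym)
  show "((\<lambda>s. fst (snd (u s))) has_vector_derivative (1 / e) *\<^sub>R g1 D (fst (u s)) (fst (snd (u s))) (snd (snd (u s))) e) (at s within {0..T})"
    using has_vector_derivative_fst[OF has_vector_derivative_snd[OF u]] by (simp add: full_field_def sym_part_eq sym)
  show "((\<lambda>s. snd (snd (u s))) has_vector_derivative (1 / e) *\<^sub>R g2 D (fst (u s)) (fst (snd (u s))) (snd (snd (u s))) e) (at s within {0..T})"
    using has_vector_derivative_snd[OF has_vector_derivative_snd[OF u]] by (simp add: full_field_def sym_part_eq sym)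
qed (simp_all add: assms(4))

lemma full_solution_if_ode:
  assumes "Q1 D \<in> Sym" "Q2 D \<in> Sym" "ode_on (full_field D e) T u" "u 0 = 0" "0 < e"
  shows "full_solution D T e (\<lambda>t. fst (u (T - t))) (\<lambda>t. fst (snd (u (T - t)))) (\<lambda>t. snd (snd (u (T - t))))"
proof -
  have rev: "\<exists>P11' P12' P22'.
      ((\<lambda>t. fst (u (T - t))) has_vector_derivative P11') (at t within {0..T}) \<and>
      ((\<lambda>t. fst (snd (u (T - t)))) has_vector_derivative P12') (at t within {0..T}) \<and>
      ((\<lambda>t. snd (snd (u (T - t)))) has_vector_derivative P22') (at t within {0..T}) \<and>
      P11' + f D (fst (u (T - t))) (fst (snd (u (T - t)))) (snd (snd (u (T - t)))) e = 0 \<and>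
      e *\<^sub>R P12' + g1 D (fst (u (T - t))) (fst (snd (u (T - t)))) (snd (snd (u (T - t)))) e = 0 \<and>
      e *\<^sub>R P22' + g2 D (fst (u (T - t))) (fst (snd (u (T - t)))) (snd (snd (u (T - t)))) e = 0"
    if t: "t \<in> {0..T}" for t
  proof -
    have s: "T - t \<in> {0..T}" using t by simp
    have c: "((\<lambda>s. fst (u s)) has_vector_derivative f D (fst (u (T - t))) (fst (snd (u (T - t)))) (snd (snd (u (T - t)))) e) (at (T - t) within {0..T})"
      "((\<lambda>s. fst (snd (u s))) has_vector_derivative (1 / e) *\<^sub>R g1 D (fst (u (T - t))) (fst (snd (u (T - t)))) (snd (snd (u (T - t)))) e) (at (T - t) within {0..T})"
      "((\<lambda>s. snd (snd (u s))) has_vector_derivative (1 / e) *\<^sub>R g2 D (fst (u (T - t))) (fst (snd (u (T - t)))) (snd (snd (u (T - t)))) e) (at (T - t) within {0..T})"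
      using reversed_solution_if_ode[OF assms(1-4)] s unfolding reversed_solution_def by blast+
    show ?thesis
      using reverse_time_derivative[OF c(1) t] reverse_time_derivative[OF c(2) t] reverse_time_derivative[OF c(3) t]
      by (intro exI conjI) (assumption | use \<open>0 < e\<close> in simp)+
  qed
  have cont: "continuous_on {0..T} (\<lambda>t. fst (u (T - t)))" "continuous_on {0..T} (\<lambda>t. fst (snd (u (T - t))))"
    "continuous_on {0..T} (\<lambda>t. snd (snd (u (T - t))))"
    unfolding continuous_on_eq_continuous_within using rev has_vector_derivative_continuous by blast+
  show ?thesis
    unfolding full_solution_def
    using cont rev assms(4) full_field_symmetric[OF assms(1-4)]
    by auto
qed

section \<open>The full system and its layer approximation\<close>

theorem theorem4p4:
  fixes D :: "('n1::finite, 'n2::finite, 'k1::finite, 'k2::finite) riccati_data"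
    and T \<gamma> \<delta> q2 :: real
    and Pbar22 :: "real ^ 'n2 ^ 'n2"
    and Pbar11 :: "real \<Rightarrow> real ^ 'n1 ^ 'n1"
  assumes "Q1 D \<in> Sym" and "Q2 D \<in> Sym"
    and "T > 0"
    and i: "invertible (Delta2 D)"
    and ii: "Pbar22 \<in> Sym"
      "(A22 D)\<^sup>\<top> ** Pbar22 + Pbar22 ** A22 D + Pbar22 ** Delta2 D ** Pbar22 + Q2 D = 0"
      "\<forall>z. is_eigenvalue (Smat D Pbar22) z \<longrightarrow> Re z < 0"
    and iii: "reduced_solution D T Pbar11"
      "\<forall>P. reduced_solution D T P \<longrightarrow> (\<forall>t\<in>{0..T}. P t = Pbar11 t)"
    and iv: "\<gamma> > 0" "sym_part (Smat D Pbar22) \<preceq> (- \<gamma>) *\<^sub>R mat 1"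
    and v: "0 < \<delta>" "\<delta> < \<gamma>"
      "is_largest_radius D Pbar22 \<delta> q2"
      "- Pbar22 \<in> top_of_set Sym interior_of sym_cball q2"
  shows "\<exists>Phat12 Phat22.
    boundary_layer_solution D Pbar22 Phat12 Phat22 \<and>
    (\<forall>R12 R22. boundary_layer_solution D Pbar22 R12 R22 \<longrightarrow>
       (\<forall>\<tau>\<ge>0. R12 \<tau> = Phat12 \<tau> \<and> R22 \<tau> = Phat22 \<tau>)) \<and>
    (\<exists>\<epsilon>star C. 0 < \<epsilon>star \<and> \<epsilon>star \<le> 1 \<and>
       (\<forall>\<epsilon>. 0 < \<epsilon> \<and> \<epsilon> < \<epsilon>star \<longrightarrow>
          (\<exists>P11 P12 P22.
             full_solution D T \<epsilon> P11 P12 P22 \<and>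
             (\<forall>R11 R12 R22. full_solution D T \<epsilon> R11 R12 R22 \<longrightarrow>
                (\<forall>t\<in>{0..T}. R11 t = P11 t \<and> R12 t = P12 t \<and> R22 t = P22 t)) \<and>
             (\<forall>t\<in>{0..T}.
                norm (P11 t - Pbar11 t) \<le> C * \<epsilon> \<and>
                norm (P12 t - hfun D Pbar22 (Pbar11 t) - Phat12 ((T - t) / \<epsilon>)) \<le> C * \<epsilon> \<and>
                norm (P22 t - Pbar22 - Phat22 ((T - t) / \<epsilon>)) \<le> C * \<epsilon>))))"
proof -
  interpret stable_layer D Pbar22 \<gamma>
    by (rule stable_layer.intro[OF assms(1,2) i ii(1,2) iv])
  have ball: "sym_part (S + Delta2 D ** z) \<preceq> \<delta> *\<^sub>R mat 1" if "z \<in> Sym" "norm z \<le> q2" for z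
    using v(3) that unfolding is_largest_radius_def region_def sym_cball_def by auto
  have small: "norm Pbar22 < q2"
    using norm_less_if_interior_sym_cball[OF v(4)] by simp
  obtain Y Z m K where YZ: "boundary_layer_solution D Pbar22 Y Z" and m: "0 < m" and K: "0 \<le> K"
    and Y_le: "\<And>s. 0 \<le> s \<Longrightarrow> norm (Y s) \<le> K * exp (- m * s)"
    and Z_le: "\<And>s. 0 \<le> s \<Longrightarrow> norm (Z s) \<le> K * exp (- m * s)"
  proof (rule boundary_layer_exists[OF v(2) _ small])
    show "sym_part (S + Delta2 D ** z) \<preceq> \<delta> *\<^sub>R mat 1" if "z \<in> Sym" "norm z \<le> q2" for z
      by (rule ball[OF that])
  qed (rule that)
  define X where "X s = Pbar11 (T - s)" for s
  have X: "(X has_vector_derivative f D (X s) (h (X s)) 0 0) (at s within {0..T})" if s: "s \<in> {0..T}" for s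
  proof -
    have t: "T - s \<in> {0..T}" using s by simp
    have sym: "Pbar11 (T - s) \<in> Sym" using iii(1) t unfolding reduced_solution_def by blast
    obtain P' where P': "(Pbar11 has_vector_derivative P') (at (T - s) within {0..T})"
      "P' + (Atilde D)\<^sup>\<top> ** Pbar11 (T - s) + Pbar11 (T - s) ** Atilde D
        + Pbar11 (T - s) ** Mmat D ** Pbar11 (T - s) + Nmat D = 0"
      using iii(1) t unfolding reduced_solution_def by blast
    then have "P' + f D (Pbar11 (T - s)) (h (Pbar11 (T - s))) 0 0 = 0"
      unfolding reduced_vector_field[OF sym] by (simp add: ac_simps)
    then have "- P' = f D (X s) (h (X s)) 0 0"
      unfolding X_def by (rule minus_unique)
    then show ?thesis
      using reverse_time_derivative[OF P'(1) s] unfolding X_def by simp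
  qed
  have X0: "X 0 = 0" using iii(1) by (simp add: X_def reduced_solution_def)
  have T: "0 \<le> T" using \<open>T > 0\<close> by simp
  obtain r M where r: "0 < r" and M: "0 \<le> M" and estimate:
    "\<And>e t x y z. 0 < e \<Longrightarrow> e \<le> 1 \<Longrightarrow> t \<in> {0..T} \<Longrightarrow> reversed_solution D e t x y z \<Longrightarrow>
      \<forall>s\<in>{0..t}. norm (x s - X s) \<le> r \<and> norm (y s - (h (X s) + Y (s / e))) \<le> r
        \<and> norm (z s - (Z (s / e) + Pbar22)) \<le> r \<Longrightarrow>
      norm (x t - X t) \<le> M * e \<and> norm (y t - (h (X t) + Y (t / e))) \<le> M * e
        \<and> norm (z t - (Z (t / e) + Pbar22)) \<le> M * e"
    using layer_error_estimate[OF X X0 T YZ m K Y_le Z_le] by blast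
  \<comment> \<open>The three errors add up to at most \<open>3 * M * e\<close>, which must be less than the
    tube radius.\<close>
  define \<epsilon>0 where "\<epsilon>0 = min 1 (r / (3 * M + 1))"
  have \<epsilon>0: "0 < \<epsilon>0" "\<epsilon>0 \<le> 1" using r M by (auto simp: \<epsilon>0_def)
  have solution: "\<exists>P11 P12 P22.
      full_solution D T e P11 P12 P22 \<and>
      (\<forall>R11 R12 R22. full_solution D T e R11 R12 R22 \<longrightarrow>
        (\<forall>t\<in>{0..T}. R11 t = P11 t \<and> R12 t = P12 t \<and> R22 t = P22 t)) \<and>
      (\<forall>t\<in>{0..T}.
        norm (P11 t - Pbar11 t) \<le> M * e \<and>
        norm (P12 t - hfun D Pbar22 (Pbar11 t) - Y ((T - t) / e)) \<le> M * e \<and>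
        norm (P22 t - Pbar22 - Z ((T - t) / e)) \<le> M * e)"
    if e: "0 < e" "e < \<epsilon>0" for e
  proof -
    have e1: "e \<le> 1" using e \<epsilon>0 by simp
    have Me: "3 * (M * e) < r"
    proof -
      have "e < r / (3 * M + 1)" using e by (simp add: \<epsilon>0_def)
      then have "e * (3 * M + 1) < r" using M by (simp add: pos_less_divide_eq)
      then show ?thesis using e(1) by (simp add: algebra_simps)
    qed
    define W where "W s = (X s, h (X s) + Y (s / e), Z (s / e) + Pbar22)" for s
    have Wcont: "continuous_on {0..T} W"
    proof -
      have "continuous_on {0..T} X"
        unfolding continuous_on_eq_continuous_within using X has_vector_derivative_continuous by blast
      moreover have "continuous_on {0..T} (\<lambda>s. Y (s / e))" "continuous_on {0..T} (\<lambda>s. Z (s / e))"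
        unfolding continuous_on_eq_continuous_within
      proof (safe del: atLeastAtMost_iff)
        fix s assume s: "s \<in> {0..T}"
        show "continuous (at s within {0..T}) (\<lambda>s. Y (s / e))"
          by (rule has_vector_derivative_continuous[OF layer_time_derivative[where
                Y' = "\<lambda>\<tau>. g1 D 0 (Y \<tau> + h 0) (Z \<tau> + Pbar22) 0", OF _ e(1) s]])
             (use YZ in \<open>simp add: boundary_layer_solution_def\<close>)
        show "continuous (at s within {0..T}) (\<lambda>s. Z (s / e))"
          by (rule has_vector_derivative_continuous[OF layer_time_derivative[where
                Y' = "\<lambda>\<tau>. g2 D 0 (Y \<tau> + h 0) (Z \<tau> + Pbar22) 0", OF _ e(1) s]])
             (use YZ in \<open>simp add: boundary_layer_solution_def\<close>)
      qed
      ultimately show ?thesis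
        unfolding W_def h_affine[of "X _"]
        by (intro continuous_intros bounded_bilinear.continuous_on[OF bounded_bilinear_matrix_mult])
    qed
    have W0: "W 0 = 0"
      using YZ by (simp add: W_def X0 boundary_layer_solution_def zero_prod_def)
    have "compact (W ` {0..T})" by (intro compact_continuous_image Wcont) auto
    then obtain B where "\<forall>w\<in>W ` {0..T}. norm w \<le> B" using compact_imp_bounded bounded_iff by metis
    then have B: "norm (W s) \<le> B" if "s \<in> {0..T}" for s using that by auto
    have close: "norm (fst (u t) - X t) \<le> M * e \<and> norm (fst (snd (u t)) - (h (X t) + Y (t / e))) \<le> M * e
        \<and> norm (snd (snd (u t)) - (Z (t / e) + Pbar22)) \<le> M * e"
      if t: "t \<in> {0..T}" and u0: "u 0 = 0" and u: "ode_on (full_field D e) t u"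
        and le: "\<And>s. s \<in> {0..t} \<Longrightarrow> norm (u s - W s) - r \<le> 0" for t u
    proof (rule estimate[OF e(1) e1 t reversed_solution_if_ode[OF Q1 Q2 u u0]], intro ballI)
      fix s assume s: "s \<in> {0..t}"
      have "norm (u s - W s) \<le> r" using le[OF s] by simp
      then have "norm (fst (u s - W s)) \<le> r" "norm (fst (snd (u s - W s))) \<le> r" "norm (snd (snd (u s - W s))) \<le> r"
        using norm_triple(1-3)[of "u s - W s"] by linarith+
      then show "norm (fst (u s) - X s) \<le> r \<and> norm (fst (snd (u s)) - (h (X s) + Y (s / e))) \<le> r
        \<and> norm (snd (snd (u s)) - (Z (s / e) + Pbar22)) \<le> r"
        by (simp add: W_def)
    qed
    obtain u where u0: "u 0 = 0" and u: "ode_on (full_field D e) T u"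
      and tube: "\<And>s. s \<in> {0..T} \<Longrightarrow> norm (u s - W s) - r \<le> 0"
    proof (rule ode_exists_in_tube[where G = "\<lambda>s x. norm (x - W s) - r" and ?u0.0 = 0, OF lipschitz_on_balls_full_field T])
      have "continuous_on ({0..T} \<times> UNIV) (\<lambda>p. W (fst p))"
        by (intro continuous_on_compose2[OF Wcont] continuous_intros) auto
      then show "continuous_on ({0..T} \<times> UNIV) (\<lambda>(s, x). norm (x - W s) - r)"
        unfolding case_prod_unfold by (intro continuous_intros)
      show "norm x \<le> B + r" if "s \<in> {0..T}" "norm (x - W s) - r \<le> 0" for s x
        using norm_triangle_sub[of x "W s"] B[OF that(1)] that(2) by linarith
      show "norm (0 - W 0) - r \<le> 0" using W0 r by simp
      show "norm (v s - W s) - r < 0" if s: "s \<in> {0..T}" and v: "v 0 = 0" "ode_on (full_field D e) s v"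
        "\<And>q. q \<in> {0..s} \<Longrightarrow> norm (v q - W q) - r \<le> 0" for s v
      proof -
        note norm_triple(4)[of "v s - W s"]
        then show ?thesis using close[OF s v] Me by (simp add: W_def)
      qed
    qed blast
    define P11 where "P11 t = fst (u (T - t))" for t
    define P12 where "P12 t = fst (snd (u (T - t)))" for t
    define P22 where "P22 t = snd (snd (u (T - t)))" for t
    have sol: "full_solution D T e P11 P12 P22"
      using full_solution_if_ode[OF Q1 Q2 u u0 e(1)] by (simp add: P11_def[abs_def] P12_def[abs_def] P22_def[abs_def])
    have "norm (P11 t - Pbar11 t) \<le> M * e \<and> norm (P12 t - h (Pbar11 t) - Y ((T - t) / e)) \<le> M * e \<and>
        norm (P22 t - Pbar22 - Z ((T - t) / e)) \<le> M * e" if t: "t \<in> {0..T}" for t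
    proof -
      have s: "T - t \<in> {0..T}" using t by simp
      have "ode_on (full_field D e) (T - t) u" using t by (intro ode_on_subset[OF u]) simp
      note close[OF s u0 this tube]
      then have "norm (fst (u (T - t)) - X (T - t)) \<le> M * e
          \<and> norm (fst (snd (u (T - t))) - (h (X (T - t)) + Y ((T - t) / e))) \<le> M * e
          \<and> norm (snd (snd (u (T - t))) - (Z ((T - t) / e) + Pbar22)) \<le> M * e"
        using t by simp
      then show ?thesis by (simp add: P11_def P12_def P22_def X_def diff_diff_eq add.commute)
    qed
    then show ?thesis using sol full_solution_unique[OF sol _ e(1)] by blast
  qed
  show ?thesis
  proof (rule exI[of _ Y], rule exI[of _ Z], intro conjI YZ)
    show "\<forall>R12 R22. boundary_layer_solution D Pbar22 R12 R22 \<longrightarrow> (\<forall>\<tau>\<ge>0. R12 \<tau> = Y \<tau> \<and> R22 \<tau> = Z \<tau>)"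
      by (intro allI impI conjI; rule layer_solution_unique[OF _ YZ])
  qed (rule exI[of _ \<epsilon>0], rule exI[of _ M], intro conjI \<epsilon>0 allI impI, elim conjE, rule solution)
qed

end
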